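(* Let $N$ be a $4$-dimensional neutral space form with constant sectional curvature $L_0$. Let $M$ be a Lorentz surface and $F:M\rightarrow N$ a time-like and conformal immersion of $M$ into $N$ with zero mean curvature vector. Then the following are mutually equivalent: (a) the curvature $K$ of the metric on $M$ induced by $F$ is identically equal to $L_0$; (b) the covariant derivatives $\hat{\nabla}\Theta_{F,+}$ and $\hat{\nabla}\Theta_{F,-}$ of both of the time-like twistor lifts of $F$ are zero or light-like; (c) the normal connection $\nabla^{\perp}$ of $F$ is flat (its curvature tensor $R^{\perp}$ vanishes) and the paracomplex quartic differential $Q$ is zero or null.
   Context: All objects are smooth. Paracomplex numbers: $a+jb$ with $a,b\in\mathbb{R}$, $j^2=1$; conjugate $a-jb$; square norm $|a+jb|^2=a^2-b^2$. A nonzero paracomplex number is null if its square norm is $0$; so "zero or null" means square norm $0$. Space form: $N$ is oriented with neutral metric $h$ (signature $(2,2)$) and is taken to be $E^4_2$ if $L_0=0$, $\{x\in E^5_2 : \langle x,x\rangle =1/L_0\}$ if $L_0>0$, $\{x\in E^5_3 : \langle x,x\rangle =1/L_0\}$ if $L_0<0$, where $E^m_k$ is the $m$-dimensional pseudo-Euclidean space of index $k$ (i.e. $k$ minus signs). $\nabla$ is the Levi-Civita connection of $N$. Lorentz surface: a surface $M$ with an atlas of compatible local paracomplex coordinates $\check{w}=u+jv$, oriented by $(\partial_u,\partial_v)$. "$F$ time-like and conformal" means that the induced metric is $g=F^*h=e^{2\lambda}d\check{w}\,d\overline{\check{w}}=e^{2\lambda}(du^2-dv^2)$ for a real-valued function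 $\lambda$ in each such coordinate. $\sigma$ denotes the second fundamental form of $F$. Twistor lifts: let $\hat{h}$ be the metric on $\bigwedge^2 F^*TN$ induced by $h$, i.e. $\hat h(a\wedge b,c\wedge d)=h(a,c)h(b,d)-h(a,d)h(b,c)$, and $\hat{\nabla}$ the connection of $\bigwedge^2F^*TN$ induced by $\nabla$. Let $(e_1,e_2,e_3,e_4)$ be a local pseudo-orthonormal frame of $F^*TN$ giving the orientation of $N$, with $e_1,e_2$ space-like, $e_3,e_4$ time-like, $e_1,e_3\in dF(TM)$ and $(e_1,e_3)$ giving the orientation of $M$. The time-like twistor lifts of $F$ are the (well-defined) sections $\Theta_{F,\pm}=\frac{1}{\sqrt{2}}(e_1\wedge e_3\pm e_4\wedge e_2)$ of $\bigwedge^2F^*TN$, which satisfy $\hat h(\Theta_{F,\pm},\Theta_{F,\pm})=-1$. "$\hat{\nabla}\Theta_{F,\pm}$ is zero or light-like" means $\hat{h}(\hat{\nabla}_V\Theta_{F,\pm},\hat{\nabla}_V\Theta_{F,\pm})=0$ for every tangent vector $V$ of $M$. Quartic differential: with $\partial_{\check{w}}=\frac12(\partial_u+j\partial_v)$ and $\sigma$, $h$ extended paracomplex-bilinearly, $Q:=h(\sigma(\partial_{\check{w}},\partial_{\check{w}}),\sigma(\partial_{\check{w}},\partial_{\check{w}}))\,d\check{w}^4$, a globally defined paracomplex quartic differential on $M$. "$Q$ is zero or null" means that at every point its coefficient with respect to $d\check w^4$ is zero or null. *)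

theory Defs
  imports "HOL-Analysis.Analysis"
begin

section \<open>Paracomplex numbers\<close>

datatype paracomplex = Para (para_re: real) (para_im: real)

instantiation paracomplex :: "{comm_ring_1, real_algebra_1}"
begin

definition "0 = Para 0 0"
definition "1 = Para 1 0"
definition "z + w = Para (para_re z + para_re w) (para_im z + para_im w)"
definition "z - w = Para (para_re z - para_re w) (para_im z - para_im w)"
definition "- z = Para (- para_re z) (- para_im z)"
definition "z * w = Para (para_re z * para_re w + para_im z * para_im w)
                         (para_re z * para_im w + para_im z * para_re w)"
definition "r *\<^sub>R z = Para (r * para_re z) (r * para_im z)"

instance
  by standard
    (auto simp: zero_paracomplex_def one_paracomplex_def plus_paracomplex_def
      minus_paracomplex_def uminus_paracomplex_def times_paracomplex_def
      scaleR_paracomplex_def algebra_simps)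

end

definition para_j :: paracomplex where
  "para_j = Para 0 1"

lemma para_j_square: "para_j * para_j = 1"
  by (simp add: para_j_def times_paracomplex_def one_paracomplex_def)

definition para_cnj :: "paracomplex \<Rightarrow> paracomplex" where
  "para_cnj z = Para (para_re z) (- para_im z)"

definition para_sqnorm :: "paracomplex \<Rightarrow> real" where
  "para_sqnorm z = (para_re z)\<^sup>2 - (para_im z)\<^sup>2"

lemma para_sqnorm_eq_mult_cnj: "of_real (para_sqnorm z) = z * para_cnj z"
  by (simp add: para_sqnorm_def para_cnj_def times_paracomplex_def of_real_def
      scaleR_paracomplex_def one_paracomplex_def power2_eq_square)

definition para_null :: "paracomplex \<Rightarrow> bool" where
  "para_null z \<longleftrightarrow> z \<noteq> 0 \<and> para_sqnorm z = 0"


section \<open>Smooth maps on open subsets of the coordinate plane\<close>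

definition pd :: "2 \<Rightarrow> (real^2 \<Rightarrow> 'b::real_normed_vector) \<Rightarrow> real^2 \<Rightarrow> 'b" where
  "pd i f x = frechet_derivative f (at x) (axis i 1)"

primrec Ck_on :: "nat \<Rightarrow> (real^2) set \<Rightarrow> (real^2 \<Rightarrow> 'b::real_normed_vector) \<Rightarrow> bool" where
  "Ck_on 0 D f \<longleftrightarrow> continuous_on D f"
| "Ck_on (Suc k) D f \<longleftrightarrow> (\<forall>x\<in>D. f differentiable at x) \<and> (\<forall>i. Ck_on k D (pd i f))"

definition smooth_on :: "(real^2) set \<Rightarrow> (real^2 \<Rightarrow> 'b::real_normed_vector) \<Rightarrow> bool" where
  "smooth_on D f \<longleftrightarrow> (\<forall>k. Ck_on k D f)"


section \<open>Lorentz surfaces\<close>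

text \<open>A chart is a pair of its domain and its coordinate map; the point \<open>x\<close> of the coordinate
  plane stands for the paracomplex number \<open>x $ 1 + j (x $ 2)\<close>.\<close>

type_synonym 'm chart = "'m set \<times> ('m \<Rightarrow> real^2)"

definition chart_dom :: "'m chart \<Rightarrow> (real^2) set" where
  "chart_dom c = snd c ` fst c"

definition chart_inv :: "'m chart \<Rightarrow> real^2 \<Rightarrow> 'm" where
  "chart_inv c = inv_into (fst c) (snd c)"

text \<open>Compatible paracomplex coordinates: the coordinate changes are smooth, satisfy the
  paracomplex Cauchy-Riemann equations \<open>u'\<^sub>u = v'\<^sub>v\<close> and \<open>u'\<^sub>v = v'\<^sub>u\<close>, and, so that the frames
  \<open>(\<partial>\<^sub>u, \<partial>\<^sub>v)\<close> define an orientation, have positive Jacobian.\<close>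

definition paracomplex_compatible :: "'m chart \<Rightarrow> 'm chart \<Rightarrow> bool" where
  "paracomplex_compatible c c' \<longleftrightarrow>
     (let D = snd c ` (fst c \<inter> fst c'); \<tau> = snd c' \<circ> chart_inv c in
       smooth_on D \<tau> \<and>
       (\<forall>x\<in>D. pd 1 \<tau> x $ 1 = pd 2 \<tau> x $ 2 \<and> pd 2 \<tau> x $ 1 = pd 1 \<tau> x $ 2 \<and>
         pd 1 \<tau> x $ 1 * pd 2 \<tau> x $ 2 - pd 2 \<tau> x $ 1 * pd 1 \<tau> x $ 2 > 0))"

definition lorentz_surface :: "'m::{t2_space,second_countable_topology} chart set \<Rightarrow> bool" where
  "lorentz_surface A \<longleftrightarrow>
     (\<Union>c\<in>A. fst c) = UNIV \<and>
     (\<forall>c\<in>A. open (fst c) \<and> open (chart_dom c) \<and>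
        homeomorphism (fst c) (chart_dom c) (snd c) (chart_inv c)) \<and>
     (\<forall>c\<in>A. \<forall>c'\<in>A. paracomplex_compatible c c')"

definition local_rep :: "('m \<Rightarrow> 'b) \<Rightarrow> 'm chart \<Rightarrow> real^2 \<Rightarrow> 'b" where
  "local_rep F c = F \<circ> chart_inv c"


section \<open>Neutral space forms\<close>

text \<open>The pseudo-Euclidean space of dimension \<open>m\<close> and index \<open>k\<close> is \<open>real^'n\<close> with \<open>CARD('n) = m\<close>
  and a set \<open>Neg\<close> of \<open>k\<close> coordinates that carry a minus sign.\<close>

definition pinner :: "'n::finite set \<Rightarrow> real^'n \<Rightarrow> real^'n \<Rightarrow> real" where
  "pinner Neg x y = (\<Sum>i\<in>UNIV. (if i \<in> Neg then -1 else 1) * x $ i * y $ i)"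

lemma pinner_add_left: "pinner Neg (x + y) z = pinner Neg x z + pinner Neg y z"
  by (simp add: pinner_def algebra_simps sum.distrib)

lemma pinner_diff_left: "pinner Neg (x - y) z = pinner Neg x z - pinner Neg y z"
  by (simp add: pinner_def algebra_simps sum_subtractf)

lemma pinner_scaleR_left: "pinner Neg (r *\<^sub>R x) z = r * pinner Neg x z"
  unfolding pinner_def sum_distrib_left by (intro sum.cong refl) simp

definition neutral_ambient :: "real \<Rightarrow> 'n::finite set \<Rightarrow> bool" where
  "neutral_ambient L0 Neg \<longleftrightarrow>
     (L0 = 0 \<longrightarrow> CARD('n) = 4 \<and> card Neg = 2) \<and>
     (L0 > 0 \<longrightarrow> CARD('n) = 5 \<and> card Neg = 2) \<and>
     (L0 < 0 \<longrightarrow> CARD('n) = 5 \<and> card Neg = 3)"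

definition space_form :: "real \<Rightarrow> 'n::finite set \<Rightarrow> (real^'n) set" where
  "space_form L0 Neg = (if L0 = 0 then UNIV else {x. pinner Neg x x = 1 / L0})"

definition tangent_space :: "real \<Rightarrow> 'n::finite set \<Rightarrow> real^'n \<Rightarrow> (real^'n) set" where
  "tangent_space L0 Neg x = (if L0 = 0 then UNIV else {v. pinner Neg v x = 0})"

text \<open>Orthogonal projection of the ambient space onto the tangent space of the space form at \<open>x\<close>;
  recall \<open>\<langle>x, x\<rangle> = 1 / L0\<close> for \<open>L0 \<noteq> 0\<close>. For \<open>L0 = 0\<close> it is the identity.\<close>

definition tangent_proj :: "real \<Rightarrow> 'n::finite set \<Rightarrow> real^'n \<Rightarrow> real^'n \<Rightarrow> real^'n" where
  "tangent_proj L0 Neg x v = v - (L0 * pinner Neg v x) *\<^sub>R x"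

lemma tangent_proj_tangent:
  assumes "x \<in> space_form L0 Neg"
  shows "tangent_proj L0 Neg x v \<in> tangent_space L0 Neg x"
  using assms
  by (auto simp: space_form_def tangent_space_def tangent_proj_def pinner_diff_left
      pinner_scaleR_left split: if_splits)

lemma tangent_proj_id:
  assumes "v \<in> tangent_space L0 Neg x"
  shows "tangent_proj L0 Neg x v = v"
  using assms by (auto simp: tangent_space_def tangent_proj_def split: if_splits)

text \<open>Orientation of the space form. The bijection \<open>idx\<close> orders the ambient coordinates and thereby
  orients the ambient space; a quadric is oriented by appending the position vector. Both
  orientations arise, since a transposition of two coordinates in \<open>idx\<close> reverses the sign of
  the determinant.\<close>

definition positive_frame ::
  "real \<Rightarrow> ('n::finite \<Rightarrow> nat) \<Rightarrow> real^'n \<Rightarrow> (real^'n) list \<Rightarrow> bool" where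
  "positive_frame L0 idx x es \<longleftrightarrow>
     det (\<chi> i. (if L0 = 0 then es else es @ [x]) ! idx i) > 0"


section \<open>Bivectors\<close>

text \<open>Bivectors of the ambient space are represented by antisymmetric matrices.\<close>

definition bivector :: "real^'n \<Rightarrow> real^'n \<Rightarrow> real^'n^'n" where
  "bivector a b = (\<chi> i j. a $ i * b $ j - a $ j * b $ i)"

definition bivector_inner :: "'n::finite set \<Rightarrow> real^'n^'n \<Rightarrow> real^'n^'n \<Rightarrow> real" where
  "bivector_inner Neg A B =
     (\<Sum>i\<in>UNIV. \<Sum>j\<in>UNIV. (if i \<in> Neg then -1 else 1) * (if j \<in> Neg then -1 else 1)
        * A $ i $ j * B $ i $ j) / 2"

lemma bivector_inner_bivector:
  "bivector_inner Neg (bivector a b) (bivector c d) =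
     pinner Neg a c * pinner Neg b d - pinner Neg a d * pinner Neg b c"
proof -
  let ?s = "\<lambda>i. if i \<in> Neg then -1 else (1::real)"
  have p: "pinner Neg x y * pinner Neg z w =
      (\<Sum>i\<in>UNIV. \<Sum>j\<in>UNIV. ?s i * ?s j * (x $ i * y $ i * z $ j * w $ j))" for x y z w
    unfolding pinner_def sum_product by (intro sum.cong refl) (simp add: algebra_simps)
  have "2 * bivector_inner Neg (bivector a b) (bivector c d) =
      (\<Sum>i\<in>UNIV. \<Sum>j\<in>UNIV.
          ?s i * ?s j * (a $ i * c $ i * b $ j * d $ j) - ?s i * ?s j * (a $ i * d $ i * b $ j * c $ j)
        + (?s i * ?s j * (b $ i * d $ i * a $ j * c $ j) - ?s i * ?s j * (b $ i * c $ i * a $ j * d $ j)))"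
    unfolding bivector_inner_def bivector_def
    by (simp, intro sum.cong refl) (simp add: algebra_simps)
  also have "\<dots> = 2 * (pinner Neg a c * pinner Neg b d - pinner Neg a d * pinner Neg b c)"
    unfolding sum.distrib sum_subtractf p[symmetric] by (simp add: algebra_simps)
  finally show ?thesis by simp
qed

text \<open>The map that sends \<open>a \<and> b\<close> to \<open>P a \<and> P b\<close>, where \<open>P\<close> is the tangential projection.\<close>

definition bivector_proj ::
  "real \<Rightarrow> 'n::finite set \<Rightarrow> real^'n \<Rightarrow> real^'n^'n \<Rightarrow> real^'n^'n" where
  "bivector_proj L0 Neg x A =
     (let P = matrix (tangent_proj L0 Neg x) in P ** A ** transpose P)"


section \<open>Connections along a map into the space form\<close>

text \<open>In what follows \<open>f\<close> is the local representation of the surface in a chart, and sections along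
  \<open>f\<close> are maps on the coordinate plane. The Levi-Civita connection of the space form is the
  tangential part of the flat connection of the ambient space.\<close>

definition nabla ::
  "real \<Rightarrow> 'n::finite set \<Rightarrow> (real^2 \<Rightarrow> real^'n) \<Rightarrow> (real^2 \<Rightarrow> real^'n) \<Rightarrow> real^2 \<Rightarrow> real^2 \<Rightarrow> real^'n" where
  "nabla L0 Neg f X V x = tangent_proj L0 Neg (f x) (frechet_derivative X (at x) V)"

definition nabla_hat ::
  "real \<Rightarrow> 'n::finite set \<Rightarrow> (real^2 \<Rightarrow> real^'n) \<Rightarrow> (real^2 \<Rightarrow> real^'n^'n) \<Rightarrow> real^2 \<Rightarrow> real^2 \<Rightarrow> real^'n^'n"
  where
  "nabla_hat L0 Neg f B V x = bivector_proj L0 Neg (f x) (frechet_derivative B (at x) V)"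

text \<open>This is the connection induced on bivectors, i.e. the one given by the Leibniz rule.\<close>

lemma linear_tangent_proj: "linear (tangent_proj L0 Neg x)"
  by (rule linearI)
    (auto simp: tangent_proj_def pinner_add_left pinner_scaleR_left algebra_simps)

lemma bivector_proj_bivector:
  "bivector_proj L0 Neg x (bivector a b) =
     bivector (tangent_proj L0 Neg x a) (tangent_proj L0 Neg x b)"
proof -
  define P where "P = matrix (tangent_proj L0 Neg x)"
  have P: "tangent_proj L0 Neg x v = P *v v" for v
    unfolding P_def by (simp add: linear_tangent_proj)
  have prod: "(P *v b) $ j * (P *v a) $ i =
      (\<Sum>k\<in>UNIV. \<Sum>m\<in>UNIV. (P $ j $ k * b $ k) * (P $ i $ m * a $ m))" for a b i j
    by (simp add: matrix_vector_mult_def sum_product)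
  have "P ** bivector a b ** transpose P = bivector (P *v a) (P *v b)"
  proof (intro vec_eq_iff[THEN iffD2] allI)
    fix i j
    have "(P ** bivector a b ** transpose P) $ i $ j =
        (\<Sum>k\<in>UNIV. \<Sum>m\<in>UNIV. (P $ j $ k * b $ k) * (P $ i $ m * a $ m)
                        - (P $ j $ k * a $ k) * (P $ i $ m * b $ m))"
      unfolding matrix_matrix_mult_def transpose_def bivector_def vec_lambda_beta sum_distrib_right
      by (intro sum.cong refl) (simp only: right_diff_distrib left_diff_distrib mult_ac)
    also have "\<dots> = (P *v b) $ j * (P *v a) $ i - (P *v a) $ j * (P *v b) $ i"
      unfolding sum_subtractf prod ..
    also have "\<dots> = bivector (P *v a) (P *v b) $ i $ j"
      by (simp add: bivector_def)
    finally show "(P ** bivector a b ** transpose P) $ i $ j = bivector (P *v a) (P *v b) $ i $ j" .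
  qed
  then show ?thesis
    unfolding bivector_proj_def Let_def P[symmetric] by (simp add: P_def)
qed

lemma bounded_bilinear_bivector: "bounded_bilinear (bivector :: real^'n \<Rightarrow> real^'n \<Rightarrow> real^'n^'n)"
  unfolding bilinear_conv_bounded_bilinear[symmetric] bilinear_def
  by (auto intro!: linearI simp: bivector_def vec_eq_iff algebra_simps)

lemma bivector_proj_add:
  "bivector_proj L0 Neg x (A + B) = bivector_proj L0 Neg x A + bivector_proj L0 Neg x B"
  by (simp add: bivector_proj_def Let_def matrix_add_ldistrib
      matrix_matrix_mult_def vec_eq_iff sum.distrib distrib_left distrib_right)

lemma nabla_hat_bivector:
  fixes X Y :: "real^2 \<Rightarrow> real^'n::finite"
  assumes "X differentiable at x" "Y differentiable at x"
    and "X x \<in> tangent_space L0 Neg (f x)" "Y x \<in> tangent_space L0 Neg (f x)"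
  shows "nabla_hat L0 Neg f (\<lambda>y. bivector (X y) (Y y)) V x =
    bivector (nabla L0 Neg f X V x) (Y x) + bivector (X x) (nabla L0 Neg f Y V x)"
proof -
  have "((\<lambda>y. bivector (X y) (Y y)) has_derivative
      (\<lambda>h. bivector (X x) (frechet_derivative Y (at x) h)
         + bivector (frechet_derivative X (at x) h) (Y x))) (at x)"
    by (rule bounded_bilinear.FDERIV[OF bounded_bilinear_bivector])
      (use assms in \<open>simp_all add: frechet_derivative_works\<close>)
  then have "frechet_derivative (\<lambda>y. bivector (X y) (Y y)) (at x) =
      (\<lambda>h. bivector (X x) (frechet_derivative Y (at x) h)
         + bivector (frechet_derivative X (at x) h) (Y x))"
    by (rule frechet_derivative_at[symmetric])
  then show ?thesis
    using assms
    by (simp add: nabla_hat_def nabla_def bivector_proj_add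
        bivector_proj_bivector tangent_proj_id)
qed


section \<open>Geometry of the surface in a chart\<close>

definition induced_metric :: "'n::finite set \<Rightarrow> (real^2 \<Rightarrow> real^'n) \<Rightarrow> real^2 \<Rightarrow> real^2^2" where
  "induced_metric Neg f x = (\<chi> i j. pinner Neg (pd i f x) (pd j f x))"

text \<open>\<open>christoffel g k i j\<close> is the Christoffel symbol with upper index \<open>k\<close> of the metric \<open>g\<close>.
  The component \<open>riemann g l i j k\<close> is the coefficient of \<open>\<partial>\<^sub>l\<close> in
  \<open>R(\<partial>\<^sub>i, \<partial>\<^sub>j) \<partial>\<^sub>k\<close>, where \<open>R(X, Y) = [\<nabla>\<^sub>X, \<nabla>\<^sub>Y] - \<nabla>\<^bsub>[X, Y]\<^esub>\<close>.\<close>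

definition christoffel :: "(real^2 \<Rightarrow> real^2^2) \<Rightarrow> 2 \<Rightarrow> 2 \<Rightarrow> 2 \<Rightarrow> real^2 \<Rightarrow> real" where
  "christoffel g k i j x =
     (\<Sum>l\<in>UNIV. matrix_inv (g x) $ k $ l *
        (pd i (\<lambda>y. g y $ j $ l) x + pd j (\<lambda>y. g y $ i $ l) x - pd l (\<lambda>y. g y $ i $ j) x)) / 2"

definition riemann :: "(real^2 \<Rightarrow> real^2^2) \<Rightarrow> 2 \<Rightarrow> 2 \<Rightarrow> 2 \<Rightarrow> 2 \<Rightarrow> real^2 \<Rightarrow> real" where
  "riemann g l i j k x =
     pd i (christoffel g l j k) x - pd j (christoffel g l i k) x
     + (\<Sum>m\<in>UNIV. christoffel g l i m x * christoffel g m j k x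
                 - christoffel g l j m x * christoffel g m i k x)"

text \<open>\<open>K = g(R(\<partial>\<^sub>1, \<partial>\<^sub>2) \<partial>\<^sub>2, \<partial>\<^sub>1) / (g\<^sub>1\<^sub>1 g\<^sub>2\<^sub>2 - g\<^sub>1\<^sub>2\<^sup>2)\<close>\<close>

definition gauss_curvature :: "(real^2 \<Rightarrow> real^2^2) \<Rightarrow> real^2 \<Rightarrow> real" where
  "gauss_curvature g x = (\<Sum>l\<in>UNIV. g x $ l $ 1 * riemann g l 1 2 2 x) / det (g x)"

definition normal_part :: "'n::finite set \<Rightarrow> (real^2 \<Rightarrow> real^'n) \<Rightarrow> real^2 \<Rightarrow> real^'n \<Rightarrow> real^'n" where
  "normal_part Neg f x v =
     v - (\<Sum>i\<in>UNIV. \<Sum>j\<in>UNIV.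
           (matrix_inv (induced_metric Neg f x) $ i $ j * pinner Neg v (pd i f x)) *\<^sub>R pd j f x)"

text \<open>\<open>second_ff L0 Neg f i j\<close> is \<open>\<sigma>(\<partial>\<^sub>i, \<partial>\<^sub>j)\<close>.\<close>

definition second_ff ::
  "real \<Rightarrow> 'n::finite set \<Rightarrow> (real^2 \<Rightarrow> real^'n) \<Rightarrow> 2 \<Rightarrow> 2 \<Rightarrow> real^2 \<Rightarrow> real^'n" where
  "second_ff L0 Neg f i j x = normal_part Neg f x (nabla L0 Neg f (pd j f) (axis i 1) x)"

definition mean_curvature ::
  "real \<Rightarrow> 'n::finite set \<Rightarrow> (real^2 \<Rightarrow> real^'n) \<Rightarrow> real^2 \<Rightarrow> real^'n" where
  "mean_curvature L0 Neg f x =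
     (1/2) *\<^sub>R (\<Sum>i\<in>UNIV. \<Sum>j\<in>UNIV.
        matrix_inv (induced_metric Neg f x) $ i $ j *\<^sub>R second_ff L0 Neg f i j x)"

definition normal_section ::
  "real \<Rightarrow> 'n::finite set \<Rightarrow> (real^2) set \<Rightarrow> (real^2 \<Rightarrow> real^'n) \<Rightarrow> (real^2 \<Rightarrow> real^'n) \<Rightarrow> bool" where
  "normal_section L0 Neg D f \<xi> \<longleftrightarrow> smooth_on D \<xi> \<and>
     (\<forall>x\<in>D. \<xi> x \<in> tangent_space L0 Neg (f x) \<and> (\<forall>i. pinner Neg (\<xi> x) (pd i f x) = 0))"

definition nabla_perp ::
  "real \<Rightarrow> 'n::finite set \<Rightarrow> (real^2 \<Rightarrow> real^'n) \<Rightarrow> (real^2 \<Rightarrow> real^'n) \<Rightarrow> 2 \<Rightarrow> real^2 \<Rightarrow> real^'n" where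
  "nabla_perp L0 Neg f \<xi> i x = normal_part Neg f x (nabla L0 Neg f \<xi> (axis i 1) x)"

text \<open>\<open>R\<^sup>\<perp>(\<partial>\<^sub>i, \<partial>\<^sub>j) \<xi>\<close>; the term with the bracket of the coordinate fields vanishes.\<close>

definition normal_curvature ::
  "real \<Rightarrow> 'n::finite set \<Rightarrow> (real^2 \<Rightarrow> real^'n) \<Rightarrow> 2 \<Rightarrow> 2 \<Rightarrow> (real^2 \<Rightarrow> real^'n) \<Rightarrow> real^2 \<Rightarrow> real^'n" where
  "normal_curvature L0 Neg f i j \<xi> x =
     nabla_perp L0 Neg f (nabla_perp L0 Neg f \<xi> j) i x
     - nabla_perp L0 Neg f (nabla_perp L0 Neg f \<xi> i) j x"

text \<open>Frames that define the twistor lifts at \<open>x\<close>; \<open>e1\<close> and \<open>e3\<close> are tangent to the surface.\<close>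

definition adapted_frame ::
  "real \<Rightarrow> 'n::finite set \<Rightarrow> ('n \<Rightarrow> nat) \<Rightarrow> (real^2 \<Rightarrow> real^'n) \<Rightarrow> real^2 \<Rightarrow>
     real^'n \<Rightarrow> real^'n \<Rightarrow> real^'n \<Rightarrow> real^'n \<Rightarrow> bool" where
  "adapted_frame L0 Neg idx f x e1 e2 e3 e4 \<longleftrightarrow>
     {e1, e2, e3, e4} \<subseteq> tangent_space L0 Neg (f x) \<and>
     pinner Neg e1 e1 = 1 \<and> pinner Neg e2 e2 = 1 \<and>
     pinner Neg e3 e3 = -1 \<and> pinner Neg e4 e4 = -1 \<and>
     pinner Neg e1 e2 = 0 \<and> pinner Neg e1 e3 = 0 \<and> pinner Neg e1 e4 = 0 \<and>
     pinner Neg e2 e3 = 0 \<and> pinner Neg e2 e4 = 0 \<and> pinner Neg e3 e4 = 0 \<and>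
     (\<exists>a b c d. e1 = a *\<^sub>R pd 1 f x + b *\<^sub>R pd 2 f x \<and>
                e3 = c *\<^sub>R pd 1 f x + d *\<^sub>R pd 2 f x \<and> a * d - b * c > 0) \<and>
     positive_frame L0 idx (f x) [e1, e2, e3, e4]"

text \<open>\<open>\<Theta>\<^bsub>F,\<plusminus>\<^esub>\<close> for \<open>s = \<plusminus> 1\<close>; the value does not depend on the adapted frame.\<close>

definition twistor_lift ::
  "real \<Rightarrow> 'n::finite set \<Rightarrow> ('n \<Rightarrow> nat) \<Rightarrow> (real^2 \<Rightarrow> real^'n) \<Rightarrow> real \<Rightarrow> real^2 \<Rightarrow> real^'n^'n" where
  "twistor_lift L0 Neg idx f s x =
     (THE B. \<exists>e1 e2 e3 e4. adapted_frame L0 Neg idx f x e1 e2 e3 e4 \<and>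
        B = (1 / sqrt 2) *\<^sub>R (bivector e1 e3 + s *\<^sub>R bivector e4 e2))"

text \<open>Paracomplex-bilinear extension of the metric, and \<open>\<sigma>(\<partial>\<^sub>w, \<partial>\<^sub>w)\<close>, where
  \<open>\<partial>\<^sub>w = (\<partial>\<^sub>u + j \<partial>\<^sub>v) / 2\<close> has the components \<open>1/2\<close> and \<open>j/2\<close>.\<close>

definition para_pinner :: "'n::finite set \<Rightarrow> paracomplex^'n \<Rightarrow> paracomplex^'n \<Rightarrow> paracomplex" where
  "para_pinner Neg x y = (\<Sum>i\<in>UNIV. (if i \<in> Neg then -1 else 1) * x $ i * y $ i)"

definition del_w :: "paracomplex^2" where
  "del_w = (\<chi> i. if i = 1 then of_real (1/2) else of_real (1/2) * para_j)"

definition sigma_ww ::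
  "real \<Rightarrow> 'n::finite set \<Rightarrow> (real^2 \<Rightarrow> real^'n) \<Rightarrow> real^2 \<Rightarrow> paracomplex^'n" where
  "sigma_ww L0 Neg f x =
     (\<chi> k. \<Sum>i\<in>UNIV. \<Sum>j\<in>UNIV. del_w $ i * del_w $ j * of_real (second_ff L0 Neg f i j x $ k))"

definition quartic_coeff ::
  "real \<Rightarrow> 'n::finite set \<Rightarrow> (real^2 \<Rightarrow> real^'n) \<Rightarrow> real^2 \<Rightarrow> paracomplex" where
  "quartic_coeff L0 Neg f x = para_pinner Neg (sigma_ww L0 Neg f x) (sigma_ww L0 Neg f x)"


section \<open>Surfaces in the space form\<close>

definition timelike_conformal_immersion ::
  "real \<Rightarrow> 'n::finite set \<Rightarrow> 'm::{t2_space,second_countable_topology} chart set \<Rightarrow>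
     ('m \<Rightarrow> real^'n) \<Rightarrow> bool" where
  "timelike_conformal_immersion L0 Neg A F \<longleftrightarrow>
     range F \<subseteq> space_form L0 Neg \<and>
     (\<forall>c\<in>A. let D = chart_dom c; f = local_rep F c in
        smooth_on D f \<and>
        (\<forall>x\<in>D. inj (frechet_derivative f (at x))) \<and>
        (\<exists>l::real^2 \<Rightarrow> real. smooth_on D l \<and>
          (\<forall>x\<in>D. pinner Neg (pd 1 f x) (pd 1 f x) = exp (2 * l x) \<and>
                 pinner Neg (pd 1 f x) (pd 2 f x) = 0 \<and>
                 pinner Neg (pd 2 f x) (pd 2 f x) = - exp (2 * l x))))"

definition zero_mean_curvature ::
  "real \<Rightarrow> 'n::finite set \<Rightarrow> 'm chart set \<Rightarrow> ('m \<Rightarrow> real^'n) \<Rightarrow> bool" where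
  "zero_mean_curvature L0 Neg A F \<longleftrightarrow>
     (\<forall>c\<in>A. \<forall>x\<in>chart_dom c. mean_curvature L0 Neg (local_rep F c) x = 0)"

definition induced_curvature_constant ::
  "real \<Rightarrow> 'n::finite set \<Rightarrow> 'm chart set \<Rightarrow> ('m \<Rightarrow> real^'n) \<Rightarrow> bool" where
  "induced_curvature_constant K0 Neg A F \<longleftrightarrow>
     (\<forall>c\<in>A. \<forall>x\<in>chart_dom c. gauss_curvature (induced_metric Neg (local_rep F c)) x = K0)"

definition twistor_derivative_lightlike ::
  "real \<Rightarrow> 'n::finite set \<Rightarrow> ('n \<Rightarrow> nat) \<Rightarrow> 'm chart set \<Rightarrow> ('m \<Rightarrow> real^'n) \<Rightarrow> real \<Rightarrow> bool" where
  "twistor_derivative_lightlike L0 Neg idx A F s \<longleftrightarrow>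
     (\<forall>c\<in>A. \<forall>x\<in>chart_dom c. \<forall>V. let f = local_rep F c;
        T = nabla_hat L0 Neg f (twistor_lift L0 Neg idx f s) V x
        in bivector_inner Neg T T = 0)"

definition flat_normal_connection ::
  "real \<Rightarrow> 'n::finite set \<Rightarrow> 'm chart set \<Rightarrow> ('m \<Rightarrow> real^'n) \<Rightarrow> bool" where
  "flat_normal_connection L0 Neg A F \<longleftrightarrow>
     (\<forall>c\<in>A. \<forall>\<xi>. normal_section L0 Neg (chart_dom c) (local_rep F c) \<xi> \<longrightarrow>
        (\<forall>x\<in>chart_dom c. \<forall>i j. normal_curvature L0 Neg (local_rep F c) i j \<xi> x = 0))"

definition quartic_zero_or_null ::
  "real \<Rightarrow> 'n::finite set \<Rightarrow> 'm chart set \<Rightarrow> ('m \<Rightarrow> real^'n) \<Rightarrow> bool" where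
  "quartic_zero_or_null L0 Neg A F \<longleftrightarrow>
     (\<forall>c\<in>A. \<forall>x\<in>chart_dom c. let q = quartic_coeff L0 Neg (local_rep F c) x
        in q = 0 \<or> para_null q)"

end

theory Submission
  imports Defs
begin

text \<open>The statement is local, so fix a chart with \<open>g = e\<^sup>2\<^sup>l (du\<^sup>2 - dv\<^sup>2)\<close> and write
  \<open>\<alpha> = \<sigma>(\<partial>\<^sub>u, \<partial>\<^sub>u)\<close> and \<open>\<beta> = \<sigma>(\<partial>\<^sub>u, \<partial>\<^sub>v)\<close>. Vanishing mean curvature means \<open>\<sigma>(\<partial>\<^sub>v, \<partial>\<^sub>v) = \<alpha>\<close>, so
  \<open>\<alpha>\<close> and \<open>\<beta>\<close> determine everything. Two conditions on them matter at each point: balance,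
  \<open>\<langle>\<alpha>, \<alpha>\<rangle> = \<langle>\<beta>, \<beta>\<rangle>\<close>, and parallelism, the linear dependence of \<open>\<alpha>\<close> and \<open>\<beta>\<close>.

  By the Gauss equation, \<open>K = L0\<close> at a point is balance (\<open>curvature_balanced\<close>). By the Ricci
  equation, the normal connection is flat exactly where \<open>\<alpha>\<close> and \<open>\<beta>\<close> are parallel
  (\<open>normal_curvature_eq\<close>, \<open>flat_normal_iff\<close>). The coefficient of \<open>Q\<close> is
  \<open>(\<langle>\<alpha>, \<alpha>\<rangle> + \<langle>\<beta>, \<beta>\<rangle> + 2 j \<langle>\<alpha>, \<beta>\<rangle>) / 4\<close>; for parallel \<open>\<alpha>\<close> and \<open>\<beta>\<close> its square norm is
  \<open>(\<langle>\<alpha>, \<alpha>\<rangle> - \<langle>\<beta>, \<beta>\<rangle>)\<^sup>2 / 16\<close>. Hence (c) is balance together with parallelism. In a moving frame,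
  the square norm of the derivative of \<open>\<Theta>\<^sub>\<plusminus>\<close> along \<open>V\<close> is, up to a nonzero factor,
  \<open>(V\<^sub>1\<^sup>2 - V\<^sub>2\<^sup>2) (\<langle>\<beta>, \<beta>\<rangle> - \<langle>\<alpha>, \<alpha>\<rangle> \<plusminus> 2 \<omega>)\<close>, where \<open>\<omega>\<close> is the determinant of \<open>(\<alpha>, \<beta>)\<close> in the
  normal plane (\<open>twistor_derivative_norm\<close>). For both signs together this is again balance together
  with parallelism (\<open>twistor_both_iff\<close>).

  What remains is that balance on an open set forces parallelism, and this is not a pointwise
  fact. In the null directions \<open>\<partial>\<^sub>\<plusminus> = \<partial>\<^sub>u \<plusminus> \<partial>\<^sub>v\<close>, put \<open>A\<^sub>\<plusminus> = \<sigma>(\<partial>\<^sub>\<plusminus>, \<partial>\<^sub>\<plusminus>) = 2 (\<alpha> \<plusminus> \<beta>)\<close>. If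
  \<open>K = L0\<close>, the Codazzi equation says that the flat derivative \<open>\<partial>\<^sub>\<mp> A\<^sub>\<plusminus>\<close> in the ambient space
  vanishes. Balance is \<open>\<langle>A\<^sub>+, A\<^sub>-\<rangle> = 0\<close>, and differentiating it along \<open>\<partial>\<^sub>+\<close> and then \<open>\<partial>\<^sub>-\<close> gives
  \<open>\<langle>\<partial>\<^sub>+ A\<^sub>+, \<partial>\<^sub>- A\<^sub>-\<rangle> = 0\<close>. The tangential parts of these two vectors contribute
  \<open>\<langle>A\<^sub>+, A\<^sub>+\<rangle> \<langle>A\<^sub>-, A\<^sub>-\<rangle> / (2 e\<^sup>2\<^sup>l)\<close>, and unless \<open>A\<^sub>+\<close> and \<open>A\<^sub>-\<close> are parallel their normal parts
  are orthogonal; so one of \<open>A\<^sub>\<plusminus>\<close> is null, which in a Lorentz plane makes the two orthogonal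
  vectors parallel after all (\<open>constant_curvature_parallel\<close>).\<close>

section \<open>Calculus in the coordinate plane\<close>

lemma Ck_on_cong:
  assumes "open D" "\<And>x. x \<in> D \<Longrightarrow> f x = g x" "Ck_on k D f"
  shows "Ck_on k D g"
  using assms(2,3)
proof (induction k arbitrary: f g)
  case 0
  then show ?case by (simp cong: continuous_on_cong)
next
  case (Suc k)
  have diff: "g differentiable at x" if "x \<in> D" for x
    using Suc.prems that has_derivative_transform_within_open[OF _ assms(1) that, of f _ UNIV g]
    by (fastforce simp: differentiable_def)
  have "pd i f x = pd i g x" if "x \<in> D" for i x
    unfolding pd_def
    using frechet_derivative_transform_within_open[of f x D g] Suc.prems that assms(1) by auto
  then have "Ck_on k D (pd i g)" for i
    using Suc.IH[of "pd i f" "pd i g"] Suc.prems(2) by simp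
  with diff show ?case by simp
qed

lemma smooth_on_cong:
  assumes "open D" "\<And>x. x \<in> D \<Longrightarrow> f x = g x" "smooth_on D f"
  shows "smooth_on D g"
  using assms Ck_on_cong unfolding smooth_on_def by blast

lemma smooth_on_differentiable:
  assumes "smooth_on D f" "x \<in> D"
  shows "f differentiable at x"
  using assms Ck_on.simps(2)[of 0 D f] unfolding smooth_on_def by blast

lemma smooth_on_pd:
  assumes "smooth_on D f"
  shows "smooth_on D (pd i f)"
  using assms Ck_on.simps(2)[of _ D f] unfolding smooth_on_def by blast

lemma smooth_on_continuous_on: "smooth_on D f \<Longrightarrow> continuous_on D f"
  unfolding smooth_on_def using Ck_on.simps(1) by blast

lemma pd_eqI:
  assumes "(f has_derivative f') (at x)"
  shows "pd i f x = f' (axis i 1)"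
  unfolding pd_def using frechet_derivative_at[OF assms] by simp

lemma pd_cong_open:
  assumes "open D" "x \<in> D" "\<And>y. y \<in> D \<Longrightarrow> f y = g y"
  shows "pd i f x = pd i g x"
proof (cases "f differentiable at x")
  case True
  then show ?thesis
    unfolding pd_def using frechet_derivative_transform_within_open[OF True assms(1,2)] assms(3) by simp
next
  case False
  have "(f has_derivative f') (at x) \<longleftrightarrow> (g has_derivative f') (at x)" for f'
    using assms has_derivative_transform_within_open[of f f' x UNIV D g]
      has_derivative_transform_within_open[of g f' x UNIV D f] by auto
  then show ?thesis unfolding pd_def frechet_derivative_def by simp
qed

lemma pd_const [simp]: "pd i (\<lambda>y. c) x = 0"
  by (simp add: pd_def)

lemma pd_add:
  assumes "f differentiable at x" "g differentiable at x"
  shows "pd i (\<lambda>y. f y + g y) x = pd i f x + pd i g x"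
  using pd_eqI[OF has_derivative_add] assms unfolding frechet_derivative_works pd_def
  by fastforce

lemma pd_diff:
  assumes "f differentiable at x" "g differentiable at x"
  shows "pd i (\<lambda>y. f y - g y) x = pd i f x - pd i g x"
  using pd_eqI[OF has_derivative_diff] assms unfolding frechet_derivative_works pd_def
  by fastforce

lemma pd_bilinear:
  assumes "bounded_bilinear B" "f differentiable at x" "g differentiable at x"
  shows "pd i (\<lambda>y. B (f y) (g y)) x = B (f x) (pd i g x) + B (pd i f x) (g x)"
  using pd_eqI[OF bounded_bilinear.FDERIV[OF assms(1)]] assms(2,3)
  unfolding frechet_derivative_works pd_def by fastforce

lemma pd_bounded_linear:
  assumes "bounded_linear B" "f differentiable at x"
  shows "pd i (\<lambda>y. B (f y)) x = B (pd i f x)"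
  using pd_eqI[OF bounded_linear.has_derivative[OF assms(1)]] assms(2)
  unfolding frechet_derivative_works pd_def by fastforce

lemma differentiable_bilinear:
  assumes "bounded_bilinear B" "f differentiable at x" "g differentiable at x"
  shows "(\<lambda>y. B (f y) (g y)) differentiable at x"
  using assms bounded_bilinear.FDERIV[OF assms(1)] unfolding differentiable_def by blast

lemma smooth_on_const [simp]: "smooth_on D (\<lambda>y. c)"
proof -
  have "Ck_on k D (\<lambda>y. c)" for k and c :: 'a
  proof (induction k arbitrary: c)
    case (Suc k)
    moreover have "pd i (\<lambda>y::real^2. c) = (\<lambda>y. 0)" for i by auto
    ultimately show ?case by simp
  qed simp
  then show ?thesis by (simp add: smooth_on_def)
qed

lemma smooth_on_add:
  fixes f g :: "real^2 \<Rightarrow> 'b::real_normed_vector"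
  assumes "open D" "smooth_on D f" "smooth_on D g"
  shows "smooth_on D (\<lambda>y. f y + g y)"
proof -
  have "Ck_on k D (\<lambda>y. f y + g y)" if "smooth_on D f" "smooth_on D g"
    for k and f g :: "real^2 \<Rightarrow> 'b"
    using that
  proof (induction k arbitrary: f g)
    case 0
    then show ?case by (simp add: continuous_on_add smooth_on_continuous_on)
  next
    case (Suc k)
    have "Ck_on k D (pd i (\<lambda>y. f y + g y))" for i
      by (rule Ck_on_cong[OF assms(1) _ Suc.IH[OF smooth_on_pd[of D f i] smooth_on_pd[of D g i],
          OF Suc.prems]])
        (rule pd_add[OF Suc.prems[THEN smooth_on_differentiable], symmetric])
    then show ?case by (simp add: Suc.prems[THEN smooth_on_differentiable])
  qed
  then show ?thesis using assms by (simp add: smooth_on_def)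
qed

lemma smooth_on_bilinear:
  assumes "bounded_bilinear B" "open D" "smooth_on D f" "smooth_on D g"
  shows "smooth_on D (\<lambda>y. B (f y) (g y))"
proof -
  have "Ck_on k D (\<lambda>y. B (f y) (g y))" if "smooth_on D f" "smooth_on D g" for k f g
    using that
  proof (induction k arbitrary: f g rule: less_induct)
    case (less k)
    show ?case
    proof (cases k)
      case 0
      then show ?thesis
        using less.prems by (simp add: bounded_bilinear.continuous_on[OF assms(1)]
            smooth_on_continuous_on)
    next
      case (Suc m)
      \<comment> \<open>The induction hypothesis treats the two products of the Leibniz rule separately and at order
        \<open>m\<close> only, so closure under sums is needed at this fixed order.\<close>
      have sum: "Ck_on m D (\<lambda>y. u y + v y)" if "Ck_on m D u" "Ck_on m D v" for u v
        using that
      proof (induction m arbitrary: u v)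
        case (Suc m)
        have "Ck_on m D (pd i (\<lambda>y. u y + v y))" for i
          by (rule Ck_on_cong[OF assms(2) _ Suc.IH[of "pd i u" "pd i v"]])
            (use Suc.prems in \<open>auto simp: pd_add\<close>)
        then show ?case using Suc.prems by simp
      qed (simp add: continuous_on_add)
      have "Ck_on m D (pd i (\<lambda>y. B (f y) (g y)))" for i
        by (rule Ck_on_cong[OF assms(2) _ sum[OF less.IH[of m f "pd i g"] less.IH[of m "pd i f" g]]])
          (use Suc less.prems in \<open>simp_all add: pd_bilinear[OF assms(1)] smooth_on_differentiable
              smooth_on_pd\<close>)
      then show ?thesis
        using Suc less.prems by (simp add: differentiable_bilinear[OF assms(1)]
            smooth_on_differentiable)
    qed
  qed
  then show ?thesis using assms by (simp add: smooth_on_def)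
qed

lemma smooth_on_scaleR:
  "open D \<Longrightarrow> smooth_on D r \<Longrightarrow> smooth_on D f \<Longrightarrow> smooth_on D (\<lambda>y. r y *\<^sub>R f y)"
  by (rule smooth_on_bilinear[OF bounded_bilinear_scaleR])

lemma smooth_on_diff:
  assumes "open D" "smooth_on D f" "smooth_on D g"
  shows "smooth_on D (\<lambda>y. f y - g y)"
  using smooth_on_add[OF assms(1,2) smooth_on_scaleR[OF assms(1) smooth_on_const[of D "-1"] assms(3)]]
  by simp

text \<open>The mean value theorem in direction \<open>i\<close>, applied to a difference in direction \<open>j\<close>, and then
  once more in direction \<open>j\<close>. The left-hand side is symmetric in \<open>i\<close> and \<open>j\<close>, which is why mixed
  partial derivatives agree.\<close>

lemma second_difference_mvt:
  fixes h :: "real^2 \<Rightarrow> real"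
  assumes "t > 0" and r: "\<And>y. norm (y - x) \<le> 2 * t \<Longrightarrow> y \<in> D"
    and h: "\<And>y. y \<in> D \<Longrightarrow> h differentiable at y"
    and hi: "\<And>y. y \<in> D \<Longrightarrow> pd i h differentiable at y"
  shows "\<exists>z. norm (z - x) \<le> 2 * t \<and>
    h (x + t *\<^sub>R axis i 1 + t *\<^sub>R axis j 1) - h (x + t *\<^sub>R axis i 1) - h (x + t *\<^sub>R axis j 1) + h x
      = t * t * pd j (pd i h) z"
proof -
  let ?p = "\<lambda>a b. x + a *\<^sub>R axis i 1 + b *\<^sub>R axis j (1::real)"
  have small: "norm (?p a b - x) \<le> 2 * t" if "0 \<le> a" "a \<le> t" "0 \<le> b" "b \<le> t" for a b
    using norm_triangle_ineq[of "a *\<^sub>R axis i (1::real)" "b *\<^sub>R axis j (1::real)"] that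
    by simp
  have line: "((\<lambda>a. k (c + a *\<^sub>R axis m 1)) has_real_derivative pd m k (c + a *\<^sub>R axis m 1)) (at a)"
    if "k differentiable at (c + a *\<^sub>R axis m 1)" for k :: "real^2 \<Rightarrow> real" and c m a
  proof -
    have "((\<lambda>a. c + a *\<^sub>R axis m (1::real)) has_derivative (\<lambda>s. s *\<^sub>R axis m 1)) (at a)"
      by (auto intro!: derivative_eq_intros)
    then have "((\<lambda>a. k (c + a *\<^sub>R axis m 1)) has_derivative
        (\<lambda>s. frechet_derivative k (at (c + a *\<^sub>R axis m 1)) (s *\<^sub>R axis m 1))) (at a)"
      using has_derivative_compose that unfolding frechet_derivative_works by blast
    then show ?thesis
      unfolding has_field_derivative_def pd_def
      using linear_scale[OF linear_frechet_derivative[OF that]]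
      by (simp add: mult.commute[of _ "frechet_derivative _ _ _"])
  qed
  define \<phi> where "\<phi> a = h (?p a t) - h (?p a 0)" for a
  have "\<exists>a. 0 < a \<and> a < t \<and> \<phi> t - \<phi> 0 = (t - 0) * (pd i h (?p a t) - pd i h (?p a 0))"
  proof (rule MVT2[OF assms(1)])
    fix a assume a: "0 \<le> a" "a \<le> t"
    have 1: "((\<lambda>a. h ((x + b *\<^sub>R axis j 1) + a *\<^sub>R axis i 1)) has_real_derivative
        pd i h ((x + b *\<^sub>R axis j 1) + a *\<^sub>R axis i 1)) (at a)" if "0 \<le> b" "b \<le> t" for b
      by (rule line, rule h, rule r) (use small[OF a that] in \<open>simp add: algebra_simps\<close>)
    then show "(\<phi> has_real_derivative (pd i h (?p a t) - pd i h (?p a 0))) (at a)"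
      unfolding \<phi>_def using DERIV_diff[OF 1[of t] 1[of 0]] assms(1) by (simp add: algebra_simps)
  qed
  then obtain a where a: "0 < a" "a < t" "\<phi> t - \<phi> 0 = t * (pd i h (?p a t) - pd i h (?p a 0))"
    by auto
  have "\<exists>b. 0 < b \<and> b < t \<and> pd i h (?p a t) - pd i h (?p a 0) = (t - 0) * pd j (pd i h) (?p a b)"
  proof (rule MVT2[OF assms(1)])
    fix b assume b: "0 \<le> b" "b \<le> t"
    show "((\<lambda>b. pd i h (?p a b)) has_real_derivative pd j (pd i h) (?p a b)) (at b)"
      by (rule line, rule hi, rule r) (use small a b in auto)
  qed
  then obtain b where b: "0 < b" "b < t"
    "pd i h (?p a t) - pd i h (?p a 0) = t * pd j (pd i h) (?p a b)"
    by auto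
  show ?thesis
    by (rule exI[of _ "?p a b"])
      (use a b small[of a b] in \<open>auto simp: \<phi>_def algebra_simps\<close>)
qed

lemma pd_commute_real:
  fixes h :: "real^2 \<Rightarrow> real"
  assumes D: "open D" "x \<in> D" and h: "smooth_on D h"
  shows "pd i (pd j h) x = pd j (pd i h) x"
proof (rule ccontr)
  assume neq: "pd i (pd j h) x \<noteq> pd j (pd i h) x"
  define e where "e = \<bar>pd i (pd j h) x - pd j (pd i h) x\<bar> / 2"
  have e: "e > 0" using neq by (simp add: e_def)
  have "continuous_on D (pd i (pd j h))" "continuous_on D (pd j (pd i h))"
    using h by (simp_all add: smooth_on_pd smooth_on_continuous_on)
  then have "\<forall>\<^sub>F y in at x. dist (pd i (pd j h) y) (pd i (pd j h) x) < e"
      "\<forall>\<^sub>F y in at x. dist (pd j (pd i h) y) (pd j (pd i h) x) < e"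
    using D e by (auto simp: continuous_on_eq_continuous_at isCont_def tendsto_iff)
  then obtain d where d: "d > 0" "\<And>y. dist y x < d \<Longrightarrow> y \<in> D"
      "\<And>y. dist y x < d \<Longrightarrow> y \<noteq> x \<Longrightarrow> dist (pd i (pd j h) y) (pd i (pd j h) x) < e"
      "\<And>y. dist y x < d \<Longrightarrow> y \<noteq> x \<Longrightarrow> dist (pd j (pd i h) y) (pd j (pd i h) x) < e"
  proof -
    assume *: "\<And>d. \<lbrakk>d > 0; \<And>y. dist y x < d \<Longrightarrow> y \<in> D;
      \<And>y. dist y x < d \<Longrightarrow> y \<noteq> x \<Longrightarrow> dist (pd i (pd j h) y) (pd i (pd j h) x) < e;
      \<And>y. dist y x < d \<Longrightarrow> y \<noteq> x \<Longrightarrow> dist (pd j (pd i h) y) (pd j (pd i h) x) < e\<rbrakk> \<Longrightarrow> thesis"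
    assume "\<forall>\<^sub>F y in at x. dist (pd i (pd j h) y) (pd i (pd j h) x) < e"
      "\<forall>\<^sub>F y in at x. dist (pd j (pd i h) y) (pd j (pd i h) x) < e"
    moreover have "\<forall>\<^sub>F y in at x. y \<in> D" using D by (simp add: eventually_at_in_open')
    ultimately have "\<forall>\<^sub>F y in at x. y \<in> D \<and> dist (pd i (pd j h) y) (pd i (pd j h) x) < e
        \<and> dist (pd j (pd i h) y) (pd j (pd i h) x) < e" by eventually_elim auto
    then obtain d where "d > 0" "\<And>y. y \<noteq> x \<Longrightarrow> dist y x < d \<Longrightarrow> y \<in> D
        \<and> dist (pd i (pd j h) y) (pd i (pd j h) x) < e
        \<and> dist (pd j (pd i h) y) (pd j (pd i h) x) < e"
      unfolding eventually_at by auto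
    then show thesis using *[of d] D by metis
  qed
  have close: "\<bar>pd i (pd j h) y - pd i (pd j h) x\<bar> < e" "\<bar>pd j (pd i h) y - pd j (pd i h) x\<bar> < e"
    if "norm (y - x) < d" for y
    using d(3,4)[of y] e that by (cases "y = x"; auto simp: dist_norm)+
  define t where "t = d / 4"
  have t: "t > 0" "2 * t < d" using d by (auto simp: t_def)
  have inD: "y \<in> D" if "norm (y - x) \<le> 2 * t" for y using d(2) t that by (auto simp: dist_norm)
  have sm: "h differentiable at y" "pd i h differentiable at y" "pd j h differentiable at y" if
      "y \<in> D" for y
    using that h by (auto intro: smooth_on_differentiable smooth_on_pd)
  \<comment> \<open>The same second difference is a value of either mixed derivative near \<open>x\<close>, and
    by continuity both values are within \<open>e\<close> of the values at \<open>x\<close>, which differ by \<open>2 * e\<close>.\<close>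
  obtain z where z: "norm (z - x) \<le> 2 * t"
    "h (x + t *\<^sub>R axis i 1 + t *\<^sub>R axis j 1) - h (x + t *\<^sub>R axis i 1) - h (x + t *\<^sub>R axis j 1) + h x
      = t * t * pd j (pd i h) z"
    using second_difference_mvt[OF t(1) inD sm(1,2)] by blast
  obtain w where w: "norm (w - x) \<le> 2 * t"
    "h (x + t *\<^sub>R axis j 1 + t *\<^sub>R axis i 1) - h (x + t *\<^sub>R axis j 1) - h (x + t *\<^sub>R axis i 1) + h x
      = t * t * pd i (pd j h) w"
    using second_difference_mvt[OF t(1) inD sm(1,3)] by blast
  have "t * t * pd j (pd i h) z = t * t * pd i (pd j h) w"
    using z(2) w(2) by (simp add: algebra_simps)
  then have "pd j (pd i h) z = pd i (pd j h) w" using t by simp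
  then show False using close(2)[of z] close(1)[of w] z(1) w(1) t e_def
      by (simp add: abs_if split: if_splits)
qed

lemma pd_commute:
  fixes h :: "real^2 \<Rightarrow> 'b::real_inner"
  assumes D: "open D" "x \<in> D" and h: "smooth_on D h"
  shows "pd i (pd j h) x = pd j (pd i h) x"
proof -
  have "pd i (pd j h) x \<bullet> b = pd j (pd i h) x \<bullet> b" for b
  proof -
    have 1: "pd i (\<lambda>y. h y \<bullet> b) y = pd i h y \<bullet> b" if "y \<in> D" for i y
      by (simp add: pd_bounded_linear[OF bounded_linear_inner_left] smooth_on_differentiable[OF h that])
    have 2: "pd i (pd j (\<lambda>y. h y \<bullet> b)) x = pd i (pd j h) x \<bullet> b" for i j
      using pd_cong_open[OF D 1]
        pd_bounded_linear[OF bounded_linear_inner_left smooth_on_differentiable[OF smooth_on_pd[OF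
            h] D(2)]]
      by simp
    have "smooth_on D (\<lambda>y. h y \<bullet> b)"
      by (rule smooth_on_bilinear[OF bounded_bilinear_inner D(1) h smooth_on_const])
    from pd_commute_real[OF D this] show ?thesis by (simp add: 2)
  qed
  then have "(pd i (pd j h) x - pd j (pd i h) x) \<bullet> (pd i (pd j h) x - pd j (pd i h) x) = 0"
    by (simp only: inner_diff_left)
  then show ?thesis by simp
qed


text \<open>For \<open>s = 1\<close> and \<open>s = -1\<close> these are the derivatives along the two null directions of the
  metric \<open>du\<^sup>2 - dv\<^sup>2\<close>. Keeping \<open>s\<close> as a parameter treats both directions at once.\<close>

definition null_deriv :: "real \<Rightarrow> (real^2 \<Rightarrow> 'b::real_normed_vector) \<Rightarrow> real^2 \<Rightarrow> 'b" where
  "null_deriv s h x = pd 1 h x + s *\<^sub>R pd 2 h x"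

lemma smooth_on_null_deriv:
  assumes "open D" "smooth_on D h"
  shows "smooth_on D (null_deriv s h)"
proof -
  have "smooth_on D (\<lambda>y. pd 1 h y + s *\<^sub>R pd 2 h y)"
    using assms by (intro smooth_on_add smooth_on_scaleR smooth_on_pd smooth_on_const)
  then show ?thesis by (simp add: null_deriv_def[abs_def])
qed

lemma null_deriv_cong_open:
  assumes "open D" "x \<in> D" "\<And>y. y \<in> D \<Longrightarrow> f y = g y"
  shows "null_deriv s f x = null_deriv s g x"
  using assms by (simp add: null_deriv_def pd_cong_open[of D x f g])

lemma null_deriv_const [simp]: "null_deriv s (\<lambda>y. c) x = 0"
  by (simp add: null_deriv_def)

lemma null_deriv_diff:
  assumes "f differentiable at x" "g differentiable at x"
  shows "null_deriv s (\<lambda>y. f y - g y) x = null_deriv s f x - null_deriv s g x"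
  using assms by (simp add: null_deriv_def pd_diff algebra_simps)

lemma null_deriv_bilinear:
  assumes "bounded_bilinear B" "f differentiable at x" "g differentiable at x"
  shows "null_deriv s (\<lambda>y. B (f y) (g y)) x = B (f x) (null_deriv s g x) + B (null_deriv s f x) (g x)"
  using assms
  by (simp add: null_deriv_def pd_bilinear bounded_bilinear.add_left bounded_bilinear.add_right
      bounded_bilinear.scaleR_left bounded_bilinear.scaleR_right scaleR_right_distrib)

lemma null_deriv_null_deriv:
  fixes h :: "real^2 \<Rightarrow> 'b::real_inner"
  assumes "open D" "x \<in> D" "smooth_on D h"
  shows "null_deriv s (null_deriv t h) x =
    pd 1 (pd 1 h) x + (s + t) *\<^sub>R pd 1 (pd 2 h) x + (s * t) *\<^sub>R pd 2 (pd 2 h) x"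
proof -
  have d: "pd i h differentiable at x" for i
    using assms by (auto intro: smooth_on_differentiable smooth_on_pd)
  have "pd i (null_deriv t h) x = pd i (pd 1 h) x + t *\<^sub>R pd i (pd 2 h) x" for i
    unfolding null_deriv_def[abs_def]
    using pd_add[OF d[of 1] differentiable_bilinear[OF bounded_bilinear_scaleR
        differentiable_const d[of 2]]]
      pd_bounded_linear[OF bounded_linear_scaleR_right d[of 2]] by simp
  then show ?thesis
    by (simp add: null_deriv_def[of s] pd_commute[OF assms, of 2 1] algebra_simps)
qed

lemma null_deriv_commute:
  fixes h :: "real^2 \<Rightarrow> 'b::real_inner"
  assumes "open D" "x \<in> D" "smooth_on D h"
  shows "null_deriv s (null_deriv t h) x = null_deriv t (null_deriv s h) x"
  by (simp add: null_deriv_null_deriv[OF assms] mult.commute add.commute)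

section \<open>Pseudo-Euclidean linear algebra\<close>

lemma pinner_commute: "pinner Neg x y = pinner Neg y x"
  unfolding pinner_def by (intro sum.cong refl) simp

lemma pinner_add_right: "pinner Neg z (x + y) = pinner Neg z x + pinner Neg z y"
  by (simp add: pinner_add_left pinner_commute[of Neg z])

lemma pinner_diff_right: "pinner Neg z (x - y) = pinner Neg z x - pinner Neg z y"
  by (simp add: pinner_diff_left pinner_commute[of Neg z])

lemma pinner_scaleR_right: "pinner Neg z (r *\<^sub>R x) = r * pinner Neg z x"
  by (simp add: pinner_scaleR_left pinner_commute[of Neg z])

lemma pinner_zero_left [simp]: "pinner Neg 0 x = 0"
  and pinner_zero_right [simp]: "pinner Neg x 0 = 0"
  by (simp_all add: pinner_def)

lemma pinner_minus_left: "pinner Neg (- x) y = - pinner Neg x y"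
  using pinner_scaleR_left[of Neg "-1" x y] by simp

lemma pinner_minus_right: "pinner Neg y (- x) = - pinner Neg y x"
  by (simp add: pinner_minus_left pinner_commute[of Neg y])

lemmas pinner_simps = pinner_add_left pinner_add_right pinner_diff_left pinner_diff_right
  pinner_scaleR_left pinner_scaleR_right pinner_minus_left pinner_minus_right

lemma pinner_Compl: "pinner (- Neg) x y = - pinner Neg x y"
  unfolding pinner_def sum_negf[symmetric] by (intro sum.cong refl) auto

lemma bounded_bilinear_pinner: "bounded_bilinear (pinner Neg :: real^'n::finite \<Rightarrow> real^'n \<Rightarrow> real)"
  unfolding bilinear_conv_bounded_bilinear[symmetric] bilinear_def
  by (auto intro!: linearI simp: pinner_simps)

text \<open>The Gram matrix is \<open>M J M\<^sup>T\<close> with \<open>J\<close> the diagonal matrix of signs; it is diagonal with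
  nonzero entries, so \<open>M\<close> is invertible.\<close>

lemma orthogonal_family_det_nonzero:
  fixes b :: "'n::finite \<Rightarrow> real^'n"
  assumes "\<And>i. pinner Neg (b i) (b i) \<noteq> 0" "\<And>i j. i \<noteq> j \<Longrightarrow> pinner Neg (b i) (b j) = 0"
  shows "det (\<chi> i. b i) \<noteq> 0"
proof -
  let ?M = "\<chi> i. b i"
  let ?J = "(\<chi> i j. if i = j then (if i \<in> Neg then -1 else 1) else 0) :: real^'n^'n"
  let ?G = "?M ** ?J ** transpose ?M"
  have MJ: "(?M ** ?J) $ i $ k = (if k \<in> Neg then -1 else 1) * b i $ k" for i k
  proof -
    have "(?M ** ?J) $ i $ k = (\<Sum>l\<in>UNIV. if l = k then (if k \<in> Neg then -1 else 1) * b i $ k else 0)"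
      unfolding matrix_matrix_mult_def vec_lambda_beta by (intro sum.cong refl) auto
    then show ?thesis by simp
  qed
  have G: "?G $ i $ j = pinner Neg (b i) (b j)" for i j
    unfolding pinner_def matrix_matrix_mult_def[of "?M ** ?J"] vec_lambda_beta MJ
    by (simp add: transpose_def)
  have "det ?G = (\<Prod>i\<in>UNIV. ?G $ i $ i)"
    by (rule det_diagonal) (unfold G, rule assms(2))
  then have "det ?G \<noteq> 0" using assms(1) by (simp only: G) (simp add: prod_zero_iff)
  then show ?thesis by (auto simp: det_mul)
qed

lemma orthogonal_family_nondegenerate:
  fixes b :: "'n::finite \<Rightarrow> real^'n"
  assumes "\<And>i. pinner Neg (b i) (b i) \<noteq> 0" "\<And>i j. i \<noteq> j \<Longrightarrow> pinner Neg (b i) (b j) = 0"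
    and w: "\<And>i. pinner Neg w (b i) = 0"
  shows "w = 0"
proof -
  let ?M = "\<chi> i. b i"
  define w' where "w' = (\<chi> k. (if k \<in> Neg then -1 else 1) * w $ k)"
  have "?M *v w' = 0"
    using w by (auto simp: vec_eq_iff matrix_vector_mult_def w'_def pinner_def mult_ac)
  moreover have "inj ((*v) ?M)"
    using orthogonal_family_det_nonzero[OF assms(1,2)] det_nz_iff_inj[of "(*v) ?M"] by simp
  ultimately have "w' = 0" by (metis inj_eq matrix_vector_mult_0_right)
  then show ?thesis by (auto simp: vec_eq_iff w'_def split: if_splits)
qed

lemma card_Compl_UNIV: "card (- (Neg :: 'n::finite set)) = CARD('n) - card Neg"
  by (simp add: Compl_eq_Diff_UNIV card_Diff_subset)

text \<open>The coordinate vectors with a minus sign and \<open>C\<close> together span a proper subspace; a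
  Euclidean normal vector of it vanishes in the coordinates with a minus sign, so its indefinite
  product with any vector is the Euclidean one.\<close>

lemma exists_spacelike_orthogonal:
  fixes C :: "(real^'n::finite) set"
  assumes "finite C" "card C < card (- Neg)"
  obtains u where "pinner Neg u u > 0" "\<And>c. c \<in> C \<Longrightarrow> pinner Neg u c = 0"
proof -
  let ?S = "C \<union> (\<lambda>i. axis i 1) ` Neg"
  have "dim ?S \<le> card ?S" using assms by (intro dim_le_card) (auto intro: span_base)
  also have "\<dots> \<le> card C + card Neg"
    by (rule order_trans[OF card_Un_le]) (simp add: card_image_le)
  also have "\<dots> < CARD('n)"
    using assms(2) card_Compl_UNIV[of Neg] card_mono[of UNIV Neg] by simp
  finally have "dim ?S < DIM(real^'n)" by simp
  then obtain x where x: "x \<noteq> 0" "\<And>y. y \<in> span ?S \<Longrightarrow> orthogonal x y"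
    using orthogonal_to_subspace_exists by blast
  have neg: "x $ i = 0" if "i \<in> Neg" for i
    using x(2)[of "axis i 1"] that by (auto simp: orthogonal_def inner_axis intro: span_base)
  have inner: "pinner Neg x y = x \<bullet> y" for y
    unfolding pinner_def inner_vec_def by (intro sum.cong refl) (auto simp: neg)
  show thesis
    by (rule that[of x]) (use x in \<open>auto simp: inner orthogonal_def intro: span_base\<close>)
qed

lemma det_two_rows:
  fixes r :: "'n::finite \<Rightarrow> real^'n"
  assumes "k \<noteq> l"
  shows "det (\<chi> i. if i = k then a *\<^sub>R u + b *\<^sub>R v else if i = l then c *\<^sub>R u + d *\<^sub>R v else r i)
    = (a * d - b * c) * det (\<chi> i. if i = k then u else if i = l then v else r i)"
proof -
  define T where "T x y = det (\<chi> i. if i = k then x else if i = l then y else r i)" for x y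
  have T': "T x y = det (\<chi> i. if i = l then y else if i = k then x else r i)" for x y
    unfolding T_def using assms by (intro arg_cong[where f = det]) (auto simp: vec_eq_iff)
  have add1: "T (x + x') y = T x y + T x' y" for x x' y
    unfolding T_def using det_row_add[of k "\<lambda>_. x" "\<lambda>_. x'"] by simp
  have mul1: "T (s *\<^sub>R x) y = s * T x y" for s x y
    unfolding T_def using det_row_mul[of k s "\<lambda>_. x" "\<lambda>i. if i = l then y else r i"]
    unfolding scalar_mult_eq_scaleR .
  have add2: "T y (x + x') = T y x + T y x'" for x x' y
    unfolding T' using det_row_add[of l "\<lambda>_. x" "\<lambda>_. x'"] by simp
  have mul2: "T y (s *\<^sub>R x) = s * T y x" for s x y
    unfolding T' using det_row_mul[of l s "\<lambda>_. x" "\<lambda>i. if i = k then y else r i"]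
        unfolding scalar_mult_eq_scaleR .
  have alt: "T x x = 0" for x
    unfolding T_def by (rule det_identical_rows[OF assms]) (use assms in \<open>simp add: row_def\<close>)
  have skew: "T v u = - T u v"
    using alt[of "u + v"] alt[of u] alt[of v] unfolding add1 add2 by linarith
  have "T (a *\<^sub>R u + b *\<^sub>R v) (c *\<^sub>R u + d *\<^sub>R v) = (a * d - b * c) * T u v"
    by (simp add: add1 add2 mul1 mul2 alt skew algebra_simps)
  then show ?thesis by (simp add: T_def)
qed

lemma tangent_space_iff: "v \<in> tangent_space L0 Neg x \<longleftrightarrow> L0 * pinner Neg v x = 0"
  by (simp add: tangent_space_def)

lemma bivector_combination:
  "bivector (a *\<^sub>R u + b *\<^sub>R v) (c *\<^sub>R u + d *\<^sub>R v) = (a * d - b * c) *\<^sub>R bivector u v"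
  by (simp add: bivector_def vec_eq_iff algebra_simps)

text \<open>This provides a normal vector of the surface of positive square norm. The directions \<open>s\<close>
  and, if \<open>L0 > 0\<close>, \<open>p\<close> have positive square norm; there are too few of them to exhaust the
  positive directions. Projecting away the remaining directions \<open>t\<close> and, if \<open>L0 < 0\<close>, \<open>p\<close> only
  increases the square norm, because they are negative. Exchanging the signs of the form, of \<open>L0\<close>
  and the roles of \<open>s\<close> and \<open>t\<close> gives a normal vector of negative square norm.

  Conditions on the position vector \<open>p\<close> carry the factor \<open>L0\<close>, here and below, because they are
  meant for the quadrics only and have to be void in the flat case.\<close>

lemma exists_positive_normal:
  assumes "E > 0" "pinner Neg s s = E" "pinner Neg s t = 0" "pinner Neg t t = - E"
    and "L0 * pinner Neg s p = 0" "L0 * pinner Neg t p = 0" "L0 \<noteq> 0 \<Longrightarrow> L0 * pinner Neg p p = 1"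
    and "card (- Neg) \<ge> 2" "L0 > 0 \<Longrightarrow> card (- Neg) \<ge> 3"
  obtains v where "pinner Neg v v > 0" "pinner Neg v s = 0" "pinner Neg v t = 0"
    "L0 * pinner Neg v p = 0"
proof -
  obtain u where u: "pinner Neg u u > 0" "pinner Neg u s = 0" "L0 > 0 \<Longrightarrow> pinner Neg u p = 0"
  proof (cases "L0 > 0")
    case True
    have "card {s, p} \<le> 2" by (simp add: card_insert_if)
    then have "card {s, p} < card (- Neg)" using assms(9) True by simp
    from exists_spacelike_orthogonal[OF _ this] show thesis by (metis that insertCI finite.intros)
  next
    case False
    have "card {s} < card (- Neg)" using assms(8) by simp
    from exists_spacelike_orthogonal[OF _ this] show thesis by (metis that insertCI finite.intros False)
  qed
  define v where "v = u + (pinner Neg u t / E) *\<^sub>R t - (L0 * pinner Neg u p) *\<^sub>R p"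
  have LL: "L0 = 0 \<or> (pinner Neg s p = 0 \<and> pinner Neg t p = 0 \<and> pinner Neg p p = 1 / L0)"
    using assms(5-7) by (auto simp: field_simps)
  have comm: "pinner Neg t s = 0" "pinner Neg p s = pinner Neg s p" "pinner Neg p t = pinner Neg t p"
      "pinner Neg p u = pinner Neg u p" "pinner Neg t u = pinner Neg u t" "pinner Neg s u = 0"
    using assms(3) u(2) by (metis pinner_commute)+
  have vs: "pinner Neg v s = 0" "pinner Neg v t = 0" "L0 * pinner Neg v p = 0"
    using LL assms(1-4) u(2) by (cases "L0 = 0"; auto simp: v_def pinner_simps comm)+
  have "pinner Neg v v = pinner Neg v u"
    using vs LL by (auto simp: v_def[THEN arg_cong[where f = "pinner Neg v"]] pinner_simps)
  also have "\<dots> = pinner Neg u u + (pinner Neg u t)\<^sup>2 / E - L0 * (pinner Neg u p)\<^sup>2"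
    by (simp add: v_def pinner_simps comm power2_eq_square)
  also have "\<dots> > 0"
  proof -
    have "L0 * (pinner Neg u p)\<^sup>2 \<le> 0"
      using u(3) by (cases "L0 > 0") (auto simp: mult_nonpos_nonneg)
    moreover have "(pinner Neg u t)\<^sup>2 / E \<ge> 0" using assms(1) by simp
    ultimately show ?thesis using u(1) by linarith
  qed
  finally show thesis using that vs by blast
qed

text \<open>A pseudo-orthonormal basis of the normal plane of \<open>span {s, t}\<close> in the tangent space at \<open>p\<close>.\<close>

definition normal_pair :: "real \<Rightarrow> 'n::finite set \<Rightarrow> real^'n \<Rightarrow> real^'n \<Rightarrow> real^'n \<Rightarrow> real^'n \<Rightarrow> real^'n
    \<Rightarrow> bool"
  where
  "normal_pair L0 Neg p s t n m \<longleftrightarrow>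
     pinner Neg n n = 1 \<and> pinner Neg m m = -1 \<and> pinner Neg n m = 0 \<and>
     pinner Neg n s = 0 \<and> pinner Neg n t = 0 \<and> pinner Neg m s = 0 \<and> pinner Neg m t = 0 \<and>
     n \<in> tangent_space L0 Neg p \<and> m \<in> tangent_space L0 Neg p"

text \<open>The data at one point of the surface: the position \<open>p\<close> and the images \<open>s\<close>, \<open>t\<close> of \<open>\<partial>\<^sub>u\<close>,
  \<open>\<partial>\<^sub>v\<close>.\<close>

locale timelike_plane =
  fixes L0 :: real and Neg :: "'n::finite set" and idx :: "'n \<Rightarrow> nat" and p s t ::
      "real^'n" and E :: real
  assumes ambient: "neutral_ambient L0 Neg"
    and idx: "bij_betw idx UNIV {..<CARD('n)}"
    and p: "p \<in> space_form L0 Neg"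
    and st_tangent: "s \<in> tangent_space L0 Neg p" "t \<in> tangent_space L0 Neg p"
    and E_pos: "E > 0"
    and metric: "pinner Neg s s = E" "pinner Neg s t = 0" "pinner Neg t t = - E"
begin

lemma p_norm: "L0 \<noteq> 0 \<Longrightarrow> pinner Neg p p = 1 / L0"
  using p by (simp add: space_form_def)

lemma st_p: "L0 \<noteq> 0 \<Longrightarrow> pinner Neg s p = 0" "L0 \<noteq> 0 \<Longrightarrow> pinner Neg t p = 0"
  using st_tangent by (simp_all add: tangent_space_iff)

lemma ts: "pinner Neg t s = 0"
  using metric(2) by (simp add: pinner_commute)

lemma card_ambient: "CARD('n) = (if L0 = 0 then 4 else 5)"
  using ambient unfolding neutral_ambient_def by (cases L0 "0::real" rule: linorder_cases) auto

text \<open>The rows of the matrix whose determinant decides \<open>positive_frame\<close>.\<close>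

definition frame_row :: "real^'n \<Rightarrow> real^'n \<Rightarrow> real^'n \<Rightarrow> real^'n \<Rightarrow> 'n \<Rightarrow> real^'n" where
  "frame_row e1 e2 e3 e4 i = (if L0 = 0 then [e1, e2, e3, e4] else [e1, e2, e3, e4] @ [p]) ! idx i"

lemma positive_frame_iff:
  "positive_frame L0 idx p [e1, e2, e3, e4] \<longleftrightarrow> det (\<chi> i. frame_row e1 e2 e3 e4 i) > 0"
  unfolding positive_frame_def frame_row_def ..

lemma idx_cases:
  obtains "idx i = 0" | "idx i = 1" | "idx i = 2" | "idx i = 3" | "idx i = 4" "L0 \<noteq> 0"
proof -
  have "idx i < CARD('n)" using idx by (auto simp: bij_betw_def)
  then have "idx i = 0 \<or> idx i = 1 \<or> idx i = 2 \<or> idx i = 3 \<or> idx i = 4 \<and> L0 \<noteq> 0"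
    unfolding card_ambient by (cases "L0 = 0") auto
  then show thesis using that by blast
qed

lemma idx_inj: "idx i = idx j \<longleftrightarrow> i = j"
  using idx by (auto simp: bij_betw_def inj_def)

lemma ex_idx: "k < 4 \<Longrightarrow> \<exists>i. idx i = k"
proof -
  assume "k < 4"
  then have "k \<in> idx ` UNIV" using idx card_ambient by (auto simp: bij_betw_def)
  then show ?thesis by blast
qed

lemma row_simps:
  "idx i = 0 \<Longrightarrow> frame_row e1 e2 e3 e4 i = e1"
  "idx i = 1 \<Longrightarrow> frame_row e1 e2 e3 e4 i = e2"
  "idx i = 2 \<Longrightarrow> frame_row e1 e2 e3 e4 i = e3"
  "idx i = 3 \<Longrightarrow> frame_row e1 e2 e3 e4 i = e4"
  "idx i = 4 \<Longrightarrow> L0 \<noteq> 0 \<Longrightarrow> frame_row e1 e2 e3 e4 i = p"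
  by (auto simp: frame_row_def numeral_eq_Suc)

lemma det_row_tangent:
  "det (\<chi> i. frame_row (a *\<^sub>R u + b *\<^sub>R v) e2 (c *\<^sub>R u + d *\<^sub>R v) e4 i) = (a * d - b * c) * det
      (\<chi> i. frame_row u e2 v e4 i)"
proof -
  obtain k l where kl: "idx k = 0" "idx l = 2" using ex_idx[of 0] ex_idx[of 2] by auto
  have "k \<noteq> l" using kl by auto
  have *: "(\<chi> i. frame_row x e2 y e4 i) = (\<chi> i. if i = k then x else if i = l then y else frame_row 0 e2 0 e4 i)" for x y
  proof (intro vec_eq_iff[THEN iffD2] allI)
    fix i j
    show "(\<chi> i. frame_row x e2 y e4 i) $ i $ j = (\<chi> i. if i = k then x else if i = l then y else frame_row 0 e2 0 e4 i) $ i $ j"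
      by (rule idx_cases[of i]) (use kl in \<open>auto simp: row_simps simp flip: idx_inj\<close>)
  qed
  show ?thesis unfolding * by (rule det_two_rows[OF \<open>k \<noteq> l\<close>])
qed

lemma det_row_normal:
  "det (\<chi> i. frame_row e1 (a *\<^sub>R u + b *\<^sub>R v) e3 (c *\<^sub>R u + d *\<^sub>R v) i) = (a * d - b * c) * det
      (\<chi> i. frame_row e1 u e3 v i)"
proof -
  obtain k l where kl: "idx k = 1" "idx l = 3" using ex_idx[of 1] ex_idx[of 3] by auto
  have "k \<noteq> l" using kl by auto
  have *: "(\<chi> i. frame_row e1 x e3 y i) = (\<chi> i. if i = k then x else if i = l then y else frame_row e1 0 e3 0 i)" for x y
  proof (intro vec_eq_iff[THEN iffD2] allI)
    fix i j
    show "(\<chi> i. frame_row e1 x e3 y i) $ i $ j = (\<chi> i. if i = k then x else if i = l then y else frame_row e1 0 e3 0 i) $ i $ j"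
      by (rule idx_cases[of i]) (use kl in \<open>auto simp: row_simps simp flip: idx_inj\<close>)
  qed
  show ?thesis unfolding * by (rule det_two_rows[OF \<open>k \<noteq> l\<close>])
qed

context
  fixes n m assumes nm: "normal_pair L0 Neg p s t n m"
begin

lemma normal_pair_products:
  "pinner Neg n n = 1" "pinner Neg m m = -1" "pinner Neg n m = 0" "pinner Neg m n = 0"
  "pinner Neg n s = 0" "pinner Neg n t = 0" "pinner Neg m s = 0" "pinner Neg m t = 0"
  "pinner Neg s n = 0" "pinner Neg t n = 0" "pinner Neg s m = 0" "pinner Neg t m = 0"
  "L0 \<noteq> 0 \<Longrightarrow> pinner Neg n p = 0" "L0 \<noteq> 0 \<Longrightarrow> pinner Neg m p = 0"
  "L0 \<noteq> 0 \<Longrightarrow> pinner Neg p n = 0" "L0 \<noteq> 0 \<Longrightarrow> pinner Neg p m = 0"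
  using nm unfolding normal_pair_def tangent_space_iff by (auto simp: pinner_commute)

lemma row_orthogonal:
  "pinner Neg (frame_row s n t m i) (frame_row s n t m i) \<noteq> 0"
  "i \<noteq> j \<Longrightarrow> pinner Neg (frame_row s n t m i) (frame_row s n t m j) = 0"
proof -
  have ps: "L0 \<noteq> 0 \<Longrightarrow> pinner Neg p s = 0" "L0 \<noteq> 0 \<Longrightarrow> pinner Neg p t = 0"
    using st_p by (simp_all add: pinner_commute)
  show "pinner Neg (frame_row s n t m i) (frame_row s n t m i) \<noteq> 0"
    by (rule idx_cases[of i]) (use E_pos in \<open>auto simp: row_simps metric normal_pair_products p_norm\<close>)
  show "pinner Neg (frame_row s n t m i) (frame_row s n t m j) = 0" if "i \<noteq> j"
    by (rule idx_cases[of i]; rule idx_cases[of j])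
      (use that in \<open>auto simp: row_simps metric ts normal_pair_products p_norm st_p ps simp flip:
          idx_inj\<close>)
qed

lemma normal_pair_det_nonzero: "det (\<chi> i. frame_row s n t m i) \<noteq> 0"
  by (rule orthogonal_family_det_nonzero[of Neg]) (fact row_orthogonal)+

lemma normal_pair_expansion:
  "v = (pinner Neg v s / E) *\<^sub>R s - (pinner Neg v t / E) *\<^sub>R t + pinner Neg v n *\<^sub>R n
     - pinner Neg v m *\<^sub>R m
     + (L0 * pinner Neg v p) *\<^sub>R p"
proof -
  let ?w = "v - ((pinner Neg v s / E) *\<^sub>R s - (pinner Neg v t / E) *\<^sub>R t + pinner Neg v n *\<^sub>R n
     - pinner Neg v m *\<^sub>R m
     + (L0 * pinner Neg v p) *\<^sub>R p)"
  have ps: "L0 \<noteq> 0 \<Longrightarrow> pinner Neg p s = 0" "L0 \<noteq> 0 \<Longrightarrow> pinner Neg p t = 0"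
    using st_p by (simp_all add: pinner_commute)
  have "?w = 0"
  proof (rule orthogonal_family_nondegenerate[of Neg "frame_row s n t m"])
    have z: "L0 * a * pinner Neg p y = 0" if "y \<in> {s, n, t, m}" for a y
      using that ps normal_pair_products(15,16) by auto
    show "pinner Neg ?w (frame_row s n t m i) = 0" for i
      by (rule idx_cases[of i])
        (use E_pos in \<open>simp_all add: row_simps pinner_simps metric ts normal_pair_products p_norm
            st_p z\<close>)
  qed (fact row_orthogonal)+
  then show ?thesis by simp
qed

lemma normal_pair_parseval:
  "pinner Neg v w = (pinner Neg v s * pinner Neg w s - pinner Neg v t * pinner Neg w t) / E
    + pinner Neg v n * pinner Neg w n - pinner Neg v m * pinner Neg w m
         + L0 * pinner Neg v p * pinner Neg w p"
  by (subst normal_pair_expansion[of v])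
    (simp add: pinner_simps pinner_commute[of Neg _ w] diff_divide_distrib)

end

lemma ex_normal_pair:
  obtains n m where "normal_pair L0 Neg p s t n m" "positive_frame L0 idx p [s, n, t, m]"
proof -
  have c: "card (- Neg) \<ge> 2" "L0 > 0 \<Longrightarrow> card (- Neg) \<ge> 3" "card Neg \<ge> 2" "L0 < 0 \<Longrightarrow> card Neg \<ge> 3"
    using ambient unfolding neutral_ambient_def
    by (cases L0 "0::real" rule: linorder_cases; simp add: card_Compl_UNIV)+
  obtain n0 where n0: "pinner Neg n0 n0 > 0" "pinner Neg n0 s = 0" "pinner Neg n0 t = 0"
      "L0 * pinner Neg n0 p = 0"
    by (rule exists_positive_normal[of E Neg s t L0 p])
      (use E_pos metric st_p p_norm c in auto)
  obtain m0 where m0: "pinner (- Neg) m0 m0 > 0" "pinner (- Neg) m0 t = 0" "pinner (- Neg) m0 s = 0"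
      "- L0 * pinner (- Neg) m0 p = 0"
    by (rule exists_positive_normal[of E "- Neg" t s "- L0" p])
      (use E_pos metric ts st_p p_norm c in \<open>auto simp: pinner_Compl\<close>)
  define n where "n = (1 / sqrt (pinner Neg n0 n0)) *\<^sub>R n0"
  define m1 where "m1 = m0 - pinner Neg m0 n *\<^sub>R n"
  have n: "pinner Neg n n = 1" "pinner Neg n s = 0" "pinner Neg n t = 0" "L0 * pinner Neg n p = 0"
    using n0 by (auto simp: n_def pinner_simps)
  have "pinner Neg m1 m1 = pinner Neg m0 m0 - (pinner Neg m0 n)\<^sup>2"
    using n(1) by (simp add: m1_def pinner_simps pinner_commute[of Neg n m0] power2_eq_square)
  also have "\<dots> < 0" using m0(1) by (simp add: pinner_Compl add_strict_increasing)
      (smt (verit) zero_le_power2)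
  finally have m1: "pinner Neg m1 m1 < 0" .
  define m where "m = (1 / sqrt (- pinner Neg m1 m1)) *\<^sub>R m1"
  have mm: "pinner Neg m m = -1" using m1 by (auto simp: m_def pinner_simps)
  have m: "pinner Neg n m = 0" "pinner Neg m s = 0" "pinner Neg m t = 0" "L0 * pinner Neg m p = 0"
    using n m0 by (auto simp: m_def m1_def pinner_simps pinner_Compl pinner_commute[of Neg n m0])
  \<comment> \<open>One of the two signs of \<open>m\<close> gives the required orientation.\<close>
  have *: "normal_pair L0 Neg p s t n m" "normal_pair L0 Neg p s t n (- m)"
    using n m mm by (auto simp: normal_pair_def tangent_space_iff pinner_simps)
  have "det (\<chi> i. frame_row s n t (- m) i) = - det (\<chi> i. frame_row s n t m i)"
    using det_row_normal[of s 1 n 0 m t 0 "-1"] by simp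
  then have "det (\<chi> i. frame_row s n t m i) > 0 \<or> det (\<chi> i. frame_row s n t (- m) i) > 0"
    using normal_pair_det_nonzero[OF *(1)] by linarith
  then show thesis using that * by (auto simp: positive_frame_iff)
qed

text \<open>Well-definedness of the twistor lifts: the change between two positive normal pairs is a
  Lorentz transformation of the normal plane, of determinant \<open>1\<close> or \<open>-1\<close>, and the orientation
  excludes \<open>-1\<close>.\<close>

lemma positive_normal_pair_bivector:
  assumes nm: "normal_pair L0 Neg p s t n m" "positive_frame L0 idx p [s, n, t, m]"
    and nm': "normal_pair L0 Neg p s t n' m'" "positive_frame L0 idx p [s, n', t, m']"
  shows "bivector m' n' = bivector m n"
proof -
  note P = normal_pair_products[OF nm(1)] and P' = normal_pair_products[OF nm'(1)]
  have LL: "L0 * pinner Neg v p = 0" if "v \<in> {n', m'}" for v using P' that by auto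
  obtain a b where n': "n' = a *\<^sub>R n + b *\<^sub>R m"
    using normal_pair_expansion[OF nm(1), of n'] LL[of n'] P'(5,6)
    by (metis (no_types, opaque_lifting) add.right_neutral add_uminus_conv_diff diff_zero div_0
        insertCI scaleR_minus_left scaleR_zero_left add_0)
  obtain c d where m': "m' = c *\<^sub>R n + d *\<^sub>R m"
    using normal_pair_expansion[OF nm(1), of m'] LL[of m'] P'(7,8)
    by (metis (no_types, opaque_lifting) add.right_neutral add_uminus_conv_diff diff_zero div_0
        insertCI scaleR_minus_left scaleR_zero_left add_0)
  have "det (\<chi> i. frame_row s n' t m' i) = (a * d - b * c) * det (\<chi> i. frame_row s n t m i)"
    unfolding n' m' by (rule det_row_normal)
  then have pos: "a * d - b * c > 0"
    using nm(2) nm'(2) by (simp add: positive_frame_iff zero_less_mult_iff)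
  have "a * a - b * b = 1" "c * c - d * d = - 1" "a * c - b * d = 0"
    using P'(1-3) by (simp_all add: n' m' pinner_simps P mult.commute)
  then have "(a * d - b * c)\<^sup>2 = 1" by algebra
  then have "a * d - b * c = 1" using pos by (simp add: power2_eq_1_iff)
  then have "bivector n' m' = bivector n m" unfolding n' m' bivector_combination by simp
  then show ?thesis
    by (simp add: bivector_def vec_eq_iff) (metis minus_diff_eq mult.commute)
qed

end

section \<open>Curvature of a conformal Lorentz metric\<close>

lemma matrix_inv_lorentz:
  fixes g :: "real^2^2"
  assumes "e \<noteq> 0" "g $ 1 $ 1 = e" "g $ 1 $ 2 = 0" "g $ 2 $ 1 = 0" "g $ 2 $ 2 = - e"
  shows "matrix_inv g $ 1 $ 1 = 1 / e" "matrix_inv g $ 1 $ 2 = 0"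
    "matrix_inv g $ 2 $ 1 = 0" "matrix_inv g $ 2 $ 2 = - 1 / e"
proof -
  let ?B = "(\<chi> i j. if i = j then (if i = 1 then 1 / e else - 1 / e) else 0) :: real^2^2"
  have B: "g ** ?B = mat 1"
    unfolding vec_eq_iff forall_2 matrix_matrix_mult_def mat_def vec_lambda_beta sum_2 assms(2-5)
    using assms(1) by simp
  then have B': "?B ** g = mat 1"
    by (simp only: matrix_left_right_inverse)
  have "g ** matrix_inv g = mat 1 \<and> matrix_inv g ** g = mat 1"
    unfolding matrix_inv_def by (rule someI[of _ ?B]) (use B B' in blast)
  then have "(matrix_inv g ** g) ** ?B = ?B" "matrix_inv g ** (g ** ?B) = matrix_inv g"
    unfolding B by simp_all
  then have "matrix_inv g = ?B" unfolding matrix_mul_assoc by (metis (no_types))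
  then show "matrix_inv g $ 1 $ 1 = 1 / e" "matrix_inv g $ 1 $ 2 = 0"
    "matrix_inv g $ 2 $ 1 = 0" "matrix_inv g $ 2 $ 2 = - 1 / e"
    by simp_all
qed

lemma pd_exp_double:
  fixes l :: "real^2 \<Rightarrow> real"
  assumes "l differentiable at x"
  shows "pd i (\<lambda>y. exp (2 * l y)) x = 2 * pd i l x * exp (2 * l x)"
proof -
  have "(l has_derivative frechet_derivative l (at x)) (at x)"
    using assms by (simp add: frechet_derivative_works)
  then have "((\<lambda>y. exp (2 * l y)) has_derivative
      (\<lambda>h. exp (2 * l x) * (2 * frechet_derivative l (at x) h))) (at x)"
    by (auto intro!: derivative_eq_intros)
  from pd_eqI[OF this] show ?thesis by (simp add: pd_def)
qed

lemma pd_uminus: 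
  fixes h :: "real^2 \<Rightarrow> 'b::real_normed_vector"
  assumes "h differentiable at x"
  shows "pd i (\<lambda>y. - h y) x = - pd i h x"
  using pd_bounded_linear[OF bounded_linear_minus[OF bounded_linear_ident] assms] by simp

text \<open>The nonzero Christoffel symbols of \<open>e\<^sup>2\<^sup>l (du\<^sup>2 - dv\<^sup>2)\<close> are \<open>l\<^sub>u\<close> and \<open>l\<^sub>v\<close>; their
  quadratic terms in the curvature cancel.\<close>

lemma gauss_curvature_conformal:
  fixes l :: "real^2 \<Rightarrow> real"
  assumes D: "open D" "x \<in> D" and l: "smooth_on D l"
    and g: "\<And>y. y \<in> D \<Longrightarrow> g y $ 1 $ 1 = exp (2 * l y)" "\<And>y. y \<in> D \<Longrightarrow> g y $ 1 $ 2 = 0"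
      "\<And>y. y \<in> D \<Longrightarrow> g y $ 2 $ 1 = 0" "\<And>y. y \<in> D \<Longrightarrow> g y $ 2 $ 2 = - exp (2 * l y)"
  shows "gauss_curvature g x = - (pd 1 (pd 1 l) x - pd 2 (pd 2 l) x) / exp (2 * l x)"
proof -
  have dl: "l differentiable at y" if "y \<in> D" for y using l that by (rule smooth_on_differentiable)
  have dE: "(\<lambda>y. exp (2 * l y)) differentiable at y" if "y \<in> D" for y
    using dl[OF that] unfolding differentiable_def by (auto intro!: derivative_eq_intros)
  have dg: "pd i (\<lambda>y. g y $ 1 $ 1) y = 2 * pd i l y * exp (2 * l y)"
    "pd i (\<lambda>y. g y $ 1 $ 2) y = 0" "pd i (\<lambda>y. g y $ 2 $ 1) y = 0"
    "pd i (\<lambda>y. g y $ 2 $ 2) y = - (2 * pd i l y * exp (2 * l y))" if y: "y \<in> D" for i y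
  proof -
    show "pd i (\<lambda>y. g y $ 1 $ 1) y = 2 * pd i l y * exp (2 * l y)"
      using pd_cong_open[OF D(1) y g(1)] by (simp add: pd_exp_double dl y)
    show "pd i (\<lambda>y. g y $ 1 $ 2) y = 0" "pd i (\<lambda>y. g y $ 2 $ 1) y = 0"
      using pd_cong_open[OF D(1) y g(2)] pd_cong_open[OF D(1) y g(3)] by simp_all
    show "pd i (\<lambda>y. g y $ 2 $ 2) y = - (2 * pd i l y * exp (2 * l y))"
      using pd_cong_open[OF D(1) y g(4)] by (simp add: pd_uminus dE pd_exp_double dl y)
  qed
  have chr: "christoffel g 1 1 1 y = pd 1 l y" "christoffel g 1 1 2 y = pd 2 l y"
    "christoffel g 1 2 1 y = pd 2 l y" "christoffel g 1 2 2 y = pd 1 l y"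
    "christoffel g 2 1 1 y = pd 2 l y" "christoffel g 2 1 2 y = pd 1 l y"
    "christoffel g 2 2 1 y = pd 1 l y" "christoffel g 2 2 2 y = pd 2 l y" if y: "y \<in> D" for y
    using matrix_inv_lorentz[of "exp (2 * l y)" "g y", OF _ g[OF y]]
    unfolding christoffel_def sum_2 by (simp_all add: dg[OF y])
  have "riemann g 1 1 2 2 x = pd 1 (pd 1 l) x - pd 2 (pd 2 l) x"
    unfolding riemann_def sum_2
    by (simp add: chr[OF D(2)] pd_cong_open[OF D chr(4)] pd_cong_open[OF D chr(2)])
  then show ?thesis
    unfolding gauss_curvature_def sum_2 det_2
    by (simp add: g D(2) diff_divide_distrib)
qed


section \<open>Minimal time-like surfaces in a null coordinate patch\<close>

lemma null_deriv_pinner: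
  assumes "h differentiable at x" "k differentiable at x"
  shows "null_deriv s (\<lambda>y. pinner Neg (h y) (k y)) x
   = pinner Neg (null_deriv s h x) (k x) + pinner Neg (h x) (null_deriv s k x)"
  by (simp add: null_deriv_bilinear[OF bounded_bilinear_pinner assms])

lemma pd_pinner:
  assumes "h differentiable at x" "k differentiable at x"
  shows "pd i (\<lambda>y. pinner Neg (h y) (k y)) x = pinner Neg (pd i h x) (k x) + pinner Neg (h x)
      (pd i k x)"
  by (simp add: pd_bilinear[OF bounded_bilinear_pinner assms])

text \<open>A minimal time-like surface in one chart, with domain \<open>D\<close> and conformal factor \<open>e\<^sup>2\<^sup>l\<close>.\<close>

locale timelike_patch =
  fixes L0 :: real and Neg :: "'n::finite set" and idx :: "'n \<Rightarrow> nat" and D :: "(real^2) set"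
    and f :: "real^2 \<Rightarrow> real^'n" and l :: "real^2 \<Rightarrow> real"
  assumes ambient: "neutral_ambient L0 Neg"
    and idx: "bij_betw idx UNIV {..<CARD('n)}"
    and open_D: "open D"
    and f: "smooth_on D f" and in_space: "\<And>x. x \<in> D \<Longrightarrow> f x \<in> space_form L0 Neg"
    and l: "smooth_on D l"
    and metric: "\<And>x. x \<in> D \<Longrightarrow> pinner Neg (pd 1 f x) (pd 1 f x) = exp (2 * l x)"
      "\<And>x. x \<in> D \<Longrightarrow> pinner Neg (pd 1 f x) (pd 2 f x) = 0"
      "\<And>x. x \<in> D \<Longrightarrow> pinner Neg (pd 2 f x) (pd 2 f x) = - exp (2 * l x)"
    and minimal: "\<And>x. x \<in> D \<Longrightarrow> mean_curvature L0 Neg f x = 0"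
begin

abbreviation E :: "real^2 \<Rightarrow> real" where "E x \<equiv> exp (2 * l x)"

abbreviation D_null :: "real \<Rightarrow> real^2 \<Rightarrow> real^'n" where "D_null s \<equiv> null_deriv s f"

lemmas df = smooth_on_differentiable[OF f]
  and dpf = smooth_on_differentiable[OF smooth_on_pd[OF f]]

text \<open>With \<open>r = 1\<close> this differentiates a constant product; with \<open>r = L0\<close> it differentiates the
  relations that hold only for the quadrics.\<close>

lemma scaled_pinner_pd_zero:
  assumes h: "smooth_on D h" "smooth_on D k" and x: "x \<in> D"
    and c: "\<And>y. y \<in> D \<Longrightarrow> r * pinner Neg (h y) (k y) = c"
  shows "r * (pinner Neg (pd i h x) (k x) + pinner Neg (h x) (pd i k x)) = 0"
proof (cases "r = 0")
  case False
  then have "pinner Neg (h y) (k y) = c / r" if "y \<in> D" for y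
    using c[OF that] by (simp add: field_simps)
  then have "pd i (\<lambda>y. pinner Neg (h y) (k y)) x = 0"
    using pd_cong_open[OF open_D x, of "\<lambda>y. pinner Neg (h y) (k y)" "\<lambda>y. c / r"] by simp
  then show ?thesis
    using h x by (simp add: pd_pinner smooth_on_differentiable)
qed simp

lemma pinner_null_deriv_zero:
  assumes h: "smooth_on D h" "smooth_on D k" and x: "x \<in> D"
    and c: "\<And>y. y \<in> D \<Longrightarrow> pinner Neg (h y) (k y) = c"
  shows "pinner Neg (null_deriv s h x) (k x) + pinner Neg (h x) (null_deriv s k x) = 0"
proof -
  have "pinner Neg (pd i h x) (k x) + pinner Neg (h x) (pd i k x) = 0" for i
    using scaled_pinner_pd_zero[OF h x, of 1 c i] c by simp
  from this[of 1] this[of 2] show ?thesis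
    unfolding null_deriv_def pinner_simps by algebra
qed

lemma position_tangent: "x \<in> D \<Longrightarrow> L0 * pinner Neg (pd i f x) (f x) = 0"
proof -
  assume x: "x \<in> D"
  have "L0 * pinner Neg (f y) (f y) = (if L0 = 0 then 0 else 1)" if "y \<in> D" for y
    using in_space[OF that] by (auto simp: space_form_def)
  from scaled_pinner_pd_zero[OF f f x this]
  show ?thesis by (simp add: pinner_commute[of Neg "f x"])
qed

lemma timelike_plane_at:
  assumes "x \<in> D"
  shows "timelike_plane L0 Neg idx (f x) (pd 1 f x) (pd 2 f x) (E x)"
  using assms ambient idx in_space position_tangent metric
  by unfold_locales (auto simp: tangent_space_iff)

lemma position_second:
  assumes x: "x \<in> D"
  shows "L0 * pinner Neg (pd i (pd j f) x) (f x) = - L0 * pinner Neg (pd i f x) (pd j f x)"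
  using scaled_pinner_pd_zero[OF smooth_on_pd[OF f] f x position_tangent, of i j]
  by (simp add: pinner_commute[of Neg "pd j f x"] algebra_simps)

lemma null_position:
  assumes x: "x \<in> D"
  shows "L0 * pinner Neg (D_null s x) (f x) = 0"
  using position_tangent[OF x, of 1] position_tangent[OF x, of 2]
  by (auto simp: null_deriv_def pinner_simps algebra_simps)

lemma null_metric:
  assumes x: "x \<in> D"
  shows "pinner Neg (D_null s x) (D_null t x) = (1 - s * t) * E x"
  using metric[OF x] pinner_commute[of Neg "pd 2 f x" "pd 1 f x"]
  by (simp add: null_deriv_def pinner_simps algebra_simps)

text \<open>The projection of the ambient space onto the normal plane of the surface inside the space
  form.\<close>

definition nproj :: "real^2 \<Rightarrow> real^'n \<Rightarrow> real^'n" where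
  "nproj x v = v - (pinner Neg v (pd 1 f x) / E x) *\<^sub>R pd 1 f x
     + (pinner Neg v (pd 2 f x) / E x) *\<^sub>R pd 2 f x - (L0 * pinner Neg v (f x)) *\<^sub>R f x"

lemma normal_part_eq:
  assumes x: "x \<in> D"
  shows "normal_part Neg f x (tangent_proj L0 Neg (f x) v) = nproj x v"
proof -
  have g: "induced_metric Neg f x $ 1 $ 1 = E x" "induced_metric Neg f x $ 1 $ 2 = 0"
    "induced_metric Neg f x $ 2 $ 1 = 0" "induced_metric Neg f x $ 2 $ 2 = - E x"
    using metric[OF x] by (simp_all add: induced_metric_def pinner_commute[of Neg "pd 2 f x"
        "pd 1 f x"])
  have t: "pinner Neg (tangent_proj L0 Neg (f x) v) (pd i f x) = pinner Neg v (pd i f x)" for i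
    using position_tangent[OF x, of i]
    by (auto simp: tangent_proj_def pinner_simps pinner_commute[of Neg "f x"])
  show ?thesis
    unfolding normal_part_def sum_2
    by (simp add: matrix_inv_lorentz[OF _ g] t) (simp add: tangent_proj_def nproj_def algebra_simps)
qed

lemma second_ff_eq:
  assumes x: "x \<in> D"
  shows "second_ff L0 Neg f i j x = nproj x (pd i (pd j f) x)"
  unfolding second_ff_def nabla_def normal_part_eq[OF x] pd_def[symmetric] ..

lemma nproj_linear: "nproj x (u + v) = nproj x u + nproj x v" "nproj x (u - v) = nproj x u - nproj x v"
  "nproj x (r *\<^sub>R u) = r *\<^sub>R nproj x u"
  by (simp_all add: nproj_def pinner_simps algebra_simps add_divide_distrib diff_divide_distrib)

lemma nproj_normal:
  assumes x: "x \<in> D"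
  shows "pinner Neg (nproj x v) (pd 1 f x) = 0" "pinner Neg (nproj x v) (pd 2 f x) = 0"
    "L0 * pinner Neg (nproj x v) (f x) = 0"
proof -
  have pos: "L0 * a * pinner Neg (f x) (pd i f x) = 0" for a i
    using position_tangent[OF x, of i] by (auto simp: pinner_commute[of Neg "f x"])
  have 21: "pinner Neg (pd 2 f x) (pd 1 f x) = 0"
    using metric(2)[OF x] by (simp add: pinner_commute)
  show "pinner Neg (nproj x v) (pd 1 f x) = 0" "pinner Neg (nproj x v) (pd 2 f x) = 0"
    unfolding nproj_def pinner_simps metric[OF x] pos 21 by simp_all
  show "L0 * pinner Neg (nproj x v) (f x) = 0"
  proof (cases "L0 = 0")
    case False
    then have "pinner Neg (f x) (f x) = 1 / L0" "pinner Neg (pd i f x) (f x) = 0" for i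
      using in_space[OF x] position_tangent[OF x, of i] by (simp_all add: space_form_def)
    then show ?thesis using False by (simp add: nproj_def pinner_simps)
  qed simp
qed

lemma nproj_id:
  assumes "pinner Neg v (pd 1 f x) = 0" "pinner Neg v (pd 2 f x) = 0" "L0 * pinner Neg v (f x) = 0"
  shows "nproj x v = v"
  using assms by (simp add: nproj_def)

lemma nproj_tangent:
  assumes x: "x \<in> D"
  shows "nproj x (pd i f x) = 0"
proof -
  have "i = 1 \<or> i = 2" by (rule exhaust_2)
  then show ?thesis
    using position_tangent[OF x, of i] metric[OF x] pinner_commute[of Neg "pd 2 f x" "pd 1 f x"]
    by (auto simp: nproj_def)
qed

lemma second_ff_11_22:
  assumes x: "x \<in> D"
  shows "second_ff L0 Neg f 2 2 x = second_ff L0 Neg f 1 1 x"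
proof -
  have g: "induced_metric Neg f x $ 1 $ 1 = E x" "induced_metric Neg f x $ 1 $ 2 = 0"
    "induced_metric Neg f x $ 2 $ 1 = 0" "induced_metric Neg f x $ 2 $ 2 = - E x"
    using metric[OF x] by (simp_all add: induced_metric_def pinner_commute[of Neg "pd 2 f x"
        "pd 1 f x"])
  have "(1 / E x) *\<^sub>R second_ff L0 Neg f 1 1 x + (- 1 / E x) *\<^sub>R second_ff L0 Neg f 2 2 x = 0"
    using minimal[OF x] unfolding mean_curvature_def sum_2
    by (simp add: matrix_inv_lorentz[OF _ g])
  then have "(1 / E x) *\<^sub>R (second_ff L0 Neg f 1 1 x - second_ff L0 Neg f 2 2 x) = 0"
    by (simp add: algebra_simps)
  then show ?thesis by simp
qed

lemma second_ff_21:
  "x \<in> D \<Longrightarrow> second_ff L0 Neg f 2 1 x = second_ff L0 Neg f 1 2 x"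
  by (simp add: second_ff_eq pd_commute[OF open_D _ f, of _ 2 1])

text \<open>Minimality in null coordinates: the left-hand side is \<open>f\<^sub>u\<^sub>u - f\<^sub>v\<^sub>v\<close>, whose normal part
  vanishes. Its tangential part vanishes because \<open>f\<^sub>+\<close> and \<open>f\<^sub>-\<close> are null, and what is left is the
  component along the position vector.\<close>

lemma wave_equation:
  assumes x: "x \<in> D" and s: "s * s = 1"
  shows "null_deriv s (D_null (- s)) x = - (2 * L0 * E x) *\<^sub>R f x"
proof -
  let ?w = "null_deriv s (D_null (- s)) x"
  have w: "?w = pd 1 (pd 1 f) x - pd 2 (pd 2 f) x"
    by (simp add: null_deriv_null_deriv[OF open_D x f] s)
  have "pinner Neg ?w (D_null t x) = 0" if t: "t = s \<or> t = - s" for t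
  proof -
    have tt: "t * t = 1" using s t by auto
    have w': "?w = null_deriv (- t) (D_null t) x"
      using t null_deriv_commute[OF open_D x f, of s "- s"] by auto
    have "pinner Neg (null_deriv (- t) (D_null t) x) (D_null t x)
       + pinner Neg (D_null t x) (null_deriv (- t) (D_null t) x) = 0"
      by (rule pinner_null_deriv_zero[OF _ _ x, of _ _ 0])
        (use null_metric tt open_D f in \<open>auto intro: smooth_on_null_deriv\<close>)
    then show ?thesis by (simp add: w' pinner_commute)
  qed
  from this[of s] this[of "- s"]
  have "pinner Neg ?w (pd 1 f x) + s * pinner Neg ?w (pd 2 f x) = 0"
      "pinner Neg ?w (pd 1 f x) - s * pinner Neg ?w (pd 2 f x) = 0"
    by (simp_all add: null_deriv_def[of _ f] pinner_simps)
  then have t: "pinner Neg ?w (pd 1 f x) = 0" "pinner Neg ?w (pd 2 f x) = 0"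
    using s by auto
  have "L0 * pinner Neg ?w (f x) = - (2 * L0 * E x)"
    unfolding w pinner_diff_left right_diff_distrib position_second[OF x] metric[OF x] by simp
  moreover have "nproj x ?w = 0"
    using second_ff_11_22[OF x] by (simp add: w nproj_linear second_ff_eq[OF x])
  ultimately have "?w - (- (2 * L0 * E x)) *\<^sub>R f x = 0" by (simp only: nproj_def t) simp
  then show ?thesis by (simp only: right_minus_eq)
qed

text \<open>The normal field \<open>\<sigma>(\<partial>\<^sub>s, \<partial>\<^sub>s)\<close> for \<open>\<partial>\<^sub>s = \<partial>\<^sub>u + s \<partial>\<^sub>v\<close>. In null coordinates
  \<open>\<nabla>\<^bsub>\<partial>\<^sub>s\<^esub> \<partial>\<^sub>s = 2 l\<^sub>s \<partial>\<^sub>s\<close>, and there is no component along the position since \<open>\<partial>\<^sub>s\<close> is null. The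
  closed form shows that it is smooth.\<close>

definition Hopf :: "real \<Rightarrow> real^2 \<Rightarrow> real^'n" where
  "Hopf s x = null_deriv s (D_null s) x - (2 * null_deriv s l x) *\<^sub>R D_null s x"

lemma smooth_Hopf: "smooth_on D (Hopf s)"
proof -
  have "smooth_on D (\<lambda>x. null_deriv s (D_null s) x - (2 *\<^sub>R null_deriv s l x) *\<^sub>R D_null s x)"
    using open_D f l by (intro smooth_on_diff smooth_on_scaleR smooth_on_null_deriv smooth_on_const)
  then show ?thesis by (simp add: Hopf_def[abs_def])
qed

lemma null_deriv_E: "x \<in> D \<Longrightarrow> null_deriv s E x = 2 * null_deriv s l x * E x"
  unfolding null_deriv_def pd_exp_double[OF smooth_on_differentiable[OF l]] by (simp add: algebra_simps)

lemma smooth_E: "smooth_on D E"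
  by (rule smooth_on_cong[OF open_D metric(1)
        smooth_on_bilinear[OF bounded_bilinear_pinner open_D smooth_on_pd[OF f] smooth_on_pd[OF f]]])

lemma Hopf_normal:
  assumes x: "x \<in> D" and s: "s * s = 1"
  shows "pinner Neg (Hopf s x) (pd 1 f x) = 0" "pinner Neg (Hopf s x) (pd 2 f x) = 0"
    "L0 * pinner Neg (Hopf s x) (f x) = 0"
proof -
  have sm: "smooth_on D (D_null t)" for t using open_D f by (rule smooth_on_null_deriv)
  have nm: "null_deriv t (\<lambda>y. pinner Neg (D_null a y) (D_null b y)) x = (1
      - a * b) * null_deriv t E x" for t a b
  proof -
    have "null_deriv t (\<lambda>y. pinner Neg (D_null a y) (D_null b y)) x = null_deriv t (\<lambda>y. (1
        - a * b) *\<^sub>R E y) x"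
      by (rule null_deriv_cong_open[OF open_D x]) (simp add: null_metric)
    also have "\<dots> = (1 - a * b) * null_deriv t E x"
      using null_deriv_bilinear[OF bounded_bilinear_scaleR differentiable_const
          smooth_on_differentiable[OF smooth_E x]] by simp
    finally show ?thesis .
  qed
  have dd: "pinner Neg (null_deriv t (D_null a) x) (D_null b x) + pinner Neg (D_null a x)
      (null_deriv t (D_null b) x)
    = (1 - a * b) * null_deriv t E x" for t a b
    using nm[of t a b] null_deriv_pinner[OF smooth_on_differentiable[OF sm x]
        smooth_on_differentiable[OF sm x]]
    by simp
  have 1: "pinner Neg (Hopf s x) (D_null s x) = 0"
    using dd[of s s s] s pinner_commute[of Neg "D_null s x" "null_deriv s (D_null s) x"]
    by (simp add: Hopf_def pinner_simps null_metric[OF x])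
  have "pinner Neg (D_null s x) (null_deriv s (D_null (- s)) x) = 0"
    using wave_equation[OF x s] null_position[OF x, of s] by (auto simp: pinner_simps)
  then have 2: "pinner Neg (Hopf s x) (D_null (- s) x) = 0"
    using dd[of s s "- s"] s by (simp add: Hopf_def pinner_simps null_metric[OF x] null_deriv_E[OF x])
  have 3: "pinner Neg (Hopf s x) (pd 1 f x) + s * pinner Neg (Hopf s x) (pd 2 f x) = 0"
      "pinner Neg (Hopf s x) (pd 1 f x) - s * pinner Neg (Hopf s x) (pd 2 f x) = 0"
    using 1 2 by (simp_all add: null_deriv_def[of _ f] pinner_simps)
  then show "pinner Neg (Hopf s x) (pd 1 f x) = 0" "pinner Neg (Hopf s x) (pd 2 f x) = 0"
    using s by auto
  have "L0 * pinner Neg (null_deriv s (D_null s) x) (f x) = 0"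
    using position_second[OF x, of 1 1] position_second[OF x, of 2 2] position_second[OF x, of 1
        2] metric[OF x] s
    by (auto simp: null_deriv_null_deriv[OF open_D x f] pinner_simps algebra_simps)
  then show "L0 * pinner Neg (Hopf s x) (f x) = 0"
    using null_position[OF x, of s] by (auto simp: Hopf_def pinner_simps algebra_simps)
qed

lemma Hopf_second_ff:
  assumes x: "x \<in> D" and s: "s * s = 1"
  shows "Hopf s x = 2 *\<^sub>R (second_ff L0 Neg f 1 1 x + s *\<^sub>R second_ff L0 Neg f 1 2 x)"
proof -
  have "nproj x (D_null s x) = 0"
    by (simp add: null_deriv_def nproj_linear nproj_tangent[OF x])
  then have "nproj x (Hopf s x) = nproj x (null_deriv s (D_null s) x)"
    by (simp add: Hopf_def nproj_linear)
  then show ?thesis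
    using nproj_id[OF Hopf_normal[OF x s]] second_ff_11_22[OF x]
    by (simp add: null_deriv_null_deriv[OF open_D x f] s nproj_linear second_ff_eq[OF x]
        algebra_simps scaleR_2)
qed

lemma gauss_curvature_eq:
  assumes x: "x \<in> D"
  shows "gauss_curvature (induced_metric Neg f) x = - (pd 1 (pd 1 l) x - pd 2 (pd 2 l) x) / E x"
  by (rule gauss_curvature_conformal[OF open_D x l])
    (use metric in \<open>simp_all add: induced_metric_def pinner_commute[of Neg "pd 2 f _" "pd 1 f _"]\<close>)

text \<open>Commuting the derivatives reduces the third derivative of \<open>f\<close> to the wave equation. The
  derivative here is that of the ambient space, so one equation contains the Codazzi equation (the
  left-hand side has no normal part) and, in its tangential part, the Gauss equation.\<close>

lemma Codazzi:
  assumes x: "x \<in> D" and s: "s * s = 1"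
  shows "null_deriv (- s) (Hopf s) x =
    (2 * (gauss_curvature (induced_metric Neg f) x - L0) * E x) *\<^sub>R D_null s x"
proof -
  have sm: "smooth_on D (D_null t)" "smooth_on D (null_deriv t l)" for t
    using open_D f l by (auto intro: smooth_on_null_deriv)
  have wave: "null_deriv (- s) (D_null s) y = - (2 * L0 * E y) *\<^sub>R f y" if "y \<in> D" for y
    using wave_equation[OF that, of "- s"] s by simp
  have "null_deriv (- s) (null_deriv s (D_null s)) x = null_deriv s (null_deriv (- s) (D_null s)) x"
    by (rule null_deriv_commute[OF open_D x sm(1)])
  also have "\<dots> = null_deriv s (\<lambda>y. ((- (2 * L0)) * E y) *\<^sub>R f y) x"
    by (rule null_deriv_cong_open[OF open_D x]) (simp add: wave)
  also have "\<dots> = ((- (2 * L0)) * E x) *\<^sub>R D_null s x + ((- (2 * L0)) * null_deriv s E x) *\<^sub>R f x"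
  proof -
    have "null_deriv s (\<lambda>y. (a * E y) *\<^sub>R f y) x = (a * E x) *\<^sub>R D_null s x +
        (a * null_deriv s E x) *\<^sub>R f x" for a
      using null_deriv_bilinear[OF bounded_bilinear_scaleR differentiable_bilinear[OF
          bounded_bilinear_scaleR
            differentiable_const smooth_on_differentiable[OF smooth_E x]] df[OF x]]
        null_deriv_bilinear[OF bounded_bilinear_scaleR differentiable_const
            smooth_on_differentiable[OF smooth_E x]]
      by simp
    then show ?thesis .
  qed
  finally have 1: "null_deriv (- s) (null_deriv s (D_null s)) x =
    - (2 * L0 * E x) *\<^sub>R D_null s x - (2 * L0 * (2 * null_deriv s l x * E x)) *\<^sub>R f x"
    by (simp add: null_deriv_E[OF x])
  have "null_deriv (- s) (\<lambda>y. (2 *\<^sub>R null_deriv s l y) *\<^sub>R D_null s y) x =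
      (2 * null_deriv s l x) *\<^sub>R null_deriv (- s) (D_null s) x
      + (2 * null_deriv (- s) (null_deriv s l) x) *\<^sub>R D_null s x"
    using null_deriv_bilinear[OF bounded_bilinear_scaleR differentiable_bilinear[OF
        bounded_bilinear_scaleR
          differentiable_const smooth_on_differentiable[OF sm(2) x]] smooth_on_differentiable[OF
              sm(1) x]]
      null_deriv_bilinear[OF bounded_bilinear_scaleR differentiable_const
          smooth_on_differentiable[OF sm(2) x]]
    by simp
  then have 2: "null_deriv (- s) (\<lambda>y. (2 * null_deriv s l y) *\<^sub>R D_null s y) x =
      - ((2 * null_deriv s l x) * (2 * L0 * E x)) *\<^sub>R f x
      + (2 * (pd 1 (pd 1 l) x - pd 2 (pd 2 l) x)) *\<^sub>R D_null s x"
    by (simp add: wave[OF x] null_deriv_null_deriv[OF open_D x l] s)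
  have dif: "null_deriv s (D_null s) differentiable at x" "(\<lambda>y.
      (2 * null_deriv s l y) *\<^sub>R D_null s y) differentiable at x"
    using smooth_on_differentiable[OF smooth_on_null_deriv[OF open_D sm(1)] x]
      differentiable_bilinear[OF bounded_bilinear_scaleR differentiable_bilinear[OF
          bounded_bilinear_scaleR
          differentiable_const[of 2] smooth_on_differentiable[OF sm(2) x]]
              smooth_on_differentiable[OF sm(1) x]]
    by simp_all
  have E: "E x \<noteq> 0" by simp
  have "null_deriv (- s) (Hopf s) x = 
    - (2 * L0 * E x) *\<^sub>R D_null s x - (2 * (pd 1 (pd 1 l) x - pd 2 (pd 2 l) x)) *\<^sub>R D_null s x"
    unfolding Hopf_def[abs_def] null_deriv_diff[OF dif] 1 2 by (simp add: algebra_simps)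
  also have "\<dots> = (- (2 * L0 * E x) - 2 * (pd 1 (pd 1 l) x - pd 2 (pd 2 l) x)) *\<^sub>R D_null s x"
    by (simp add: algebra_simps)
  also have "- (2 * L0 * E x) - 2 * (pd 1 (pd 1 l) x - pd 2 (pd 2 l) x)
    = 2 * (gauss_curvature (induced_metric Neg f) x - L0) * E x"
    unfolding gauss_curvature_eq[OF x] using E by (simp add: field_simps)
  finally show ?thesis .
qed

text \<open>Differentiate \<open>\<langle>A\<^sub>+, f\<^sub>-\<rangle> = 0\<close> along \<open>\<partial>\<^sub>-\<close> and insert the tangential part of \<open>\<partial>\<^sub>- A\<^sub>+\<close>.\<close>

lemma Gauss:
  assumes x: "x \<in> D"
  shows "pinner Neg (Hopf 1 x) (Hopf (- 1) x) =
    4 * (L0 - gauss_curvature (induced_metric Neg f) x) * (E x)\<^sup>2"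
proof -
  have sm: "smooth_on D (D_null t)" for t using open_D f by (rule smooth_on_null_deriv)
  have "pinner Neg (Hopf 1 y) (D_null (- 1) y) = 0" if "y \<in> D" for y
    using Hopf_normal[OF that, of 1] by (simp add: null_deriv_def pinner_simps)
  from pinner_null_deriv_zero[OF smooth_Hopf sm x this, of "- 1"]
  have 1: "pinner Neg (null_deriv (- 1) (Hopf 1) x) (D_null (- 1) x)
    = - pinner Neg (Hopf 1 x) (null_deriv (- 1) (D_null (- 1)) x)" by simp
  have "pinner Neg (Hopf 1 x) (null_deriv (- 1) (D_null (- 1)) x) = pinner Neg (Hopf 1 x) (Hopf
      (- 1) x)"
    using Hopf_normal[OF x, of 1] by (simp add: Hopf_def[of "- 1"] pinner_simps null_deriv_def[of
        "- 1" f])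
  with 1 Codazzi[OF x, of 1] show ?thesis
    by (simp add: pinner_simps null_metric[OF x] power2_eq_square algebra_simps)
qed

end

section \<open>Constant curvature and the second fundamental form\<close>

text \<open>Vectors \<open>a\<close>, \<open>b\<close>, \<open>p\<close>, \<open>q\<close> of a Lorentz plane in pseudo-orthonormal components. If \<open>a\<close> and
  \<open>b\<close> are orthogonal and not parallel, then \<open>p\<close>, being orthogonal to \<open>b\<close>, is a multiple of \<open>a\<close>,
  and \<open>q\<close> is a multiple of \<open>b\<close>; so \<open>p\<close> and \<open>q\<close> are orthogonal and the last hypothesis makes \<open>a\<close> or
  \<open>b\<close> null. But the Gram determinant of \<open>a\<close> and \<open>b\<close> is minus the square of their determinant.\<close>

lemma lorentz_plane_parallel:
  fixes an am bn bm pn pm qn qm e :: real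
  assumes "e > 0"
    and ab: "an * bn - am * bm = 0"
    and pb: "pn * bn - pm * bm = 0"
    and aq: "an * qn - am * qm = 0"
    and pq: "(an\<^sup>2 - am\<^sup>2) * (bn\<^sup>2 - bm\<^sup>2) / (2 * e) + (pn * qn - pm * qm) = 0"
  shows "an * bm = am * bn"
proof (rule ccontr)
  assume ne: "an * bm \<noteq> am * bn"
  have "pn * qn - pm * qm = 0"
  proof (cases "an * bn = 0")
    case True
    then have "am * bm = 0" using ab by linarith
    then have "an = 0 \<and> bm = 0 \<or> bn = 0 \<and> am = 0" using True ne by auto
    then show ?thesis using ne pb aq by auto
  next
    case False
    have "(an * bn) * (pn * qn - pm * qm) = 0" using ab pb aq by algebra
    then show ?thesis using False by simp
  qed
  then have "(an\<^sup>2 - am\<^sup>2) * (bn\<^sup>2 - bm\<^sup>2) = 0" using pq assms(1) by simp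
  then have "(an * bm - am * bn)\<^sup>2 = 0" using ab by algebra
  then show False using ne by simp
qed

context timelike_patch
begin

abbreviation \<alpha> :: "real^2 \<Rightarrow> real^'n" where "\<alpha> \<equiv> second_ff L0 Neg f 1 1"
abbreviation \<beta> :: "real^2 \<Rightarrow> real^'n" where "\<beta> \<equiv> second_ff L0 Neg f 1 2"

abbreviation normal_pair_at :: "real^2 \<Rightarrow> real^'n \<Rightarrow> real^'n \<Rightarrow> bool" where
  "normal_pair_at x \<equiv> normal_pair L0 Neg (f x) (pd 1 f x) (pd 2 f x)"

text \<open>The Gram determinant of \<open>\<alpha>\<close> and \<open>\<beta>\<close> vanishes; since the normal plane is nondegenerate, this
  is their linear dependence.\<close>

definition parallel_at :: "real^2 \<Rightarrow> bool" where
  "parallel_at x \<longleftrightarrow> (pinner Neg (\<alpha> x) (\<beta> x))\<^sup>2 = pinner Neg (\<alpha> x) (\<alpha> x) * pinner Neg (\<beta> x) (\<beta> x)"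

definition balanced_at :: "real^2 \<Rightarrow> bool" where
  "balanced_at x \<longleftrightarrow> pinner Neg (\<alpha> x) (\<alpha> x) = pinner Neg (\<beta> x) (\<beta> x)"

lemma second_ff_normal:
  assumes x: "x \<in> D"
  shows "pinner Neg (second_ff L0 Neg f i j x) (pd 1 f x) = 0"
    "pinner Neg (second_ff L0 Neg f i j x) (pd 2 f x) = 0"
    "L0 * pinner Neg (second_ff L0 Neg f i j x) (f x) = 0"
  unfolding second_ff_eq[OF x] by (rule nproj_normal[OF x])+

lemma normal_products:
  assumes x: "x \<in> D" and nm: "normal_pair_at x n m"
    and v: "pinner Neg v (pd 1 f x) = 0" "pinner Neg v (pd 2 f x) = 0" "L0 * pinner Neg v (f x) = 0"
  shows "pinner Neg v w = pinner Neg v n * pinner Neg w n - pinner Neg v m * pinner Neg w m"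
proof -
  interpret timelike_plane L0 Neg idx "f x" "pd 1 f x" "pd 2 f x" "E x"
      by (rule timelike_plane_at[OF x])
  show ?thesis
    unfolding normal_pair_parseval[OF nm, of v w] v(1,2) using v(3) by auto
qed

lemma normal_zero:
  assumes x: "x \<in> D" and nm: "normal_pair_at x n m"
    and v: "pinner Neg v (pd 1 f x) = 0" "pinner Neg v (pd 2 f x) = 0" "L0 * pinner Neg v (f x) = 0"
    and "pinner Neg v n = 0" "pinner Neg v m = 0"
  shows "v = 0"
proof -
  interpret timelike_plane L0 Neg idx "f x" "pd 1 f x" "pd 2 f x" "E x"
      by (rule timelike_plane_at[OF x])
  show ?thesis
    by (subst normal_pair_expansion[OF nm, of v]) (simp only: assms(3-), simp)
qed

lemma ex_normal_pair_at:
  assumes x: "x \<in> D"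
  obtains n m where "normal_pair_at x n m" "positive_frame L0 idx (f x) [pd 1 f x, n, pd 2 f x, m]"
  using timelike_plane.ex_normal_pair[OF timelike_plane_at[OF x]] by blast

lemma parallel_at_frame:
  assumes x: "x \<in> D" and nm: "normal_pair_at x n m"
  shows "parallel_at x \<longleftrightarrow> pinner Neg (\<alpha> x) n * pinner Neg (\<beta> x) m = pinner Neg (\<alpha> x) m
      * pinner Neg (\<beta> x) n"
proof -
  note P = normal_products[OF x nm second_ff_normal[OF x]]
  have "(pinner Neg (\<alpha> x) (\<beta> x))\<^sup>2 - pinner Neg (\<alpha> x) (\<alpha> x) * pinner Neg (\<beta> x) (\<beta> x) =
    (pinner Neg (\<alpha> x) n * pinner Neg (\<beta> x) m - pinner Neg (\<alpha> x) m * pinner Neg (\<beta> x) n)\<^sup>2"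
    unfolding P[of 1 1 "\<beta> x"] P[of 1 1 "\<alpha> x"] P[of 1 2 "\<beta> x"] by algebra
  then show ?thesis unfolding parallel_at_def by (metis eq_iff_diff_eq_0 zero_eq_power2)
qed

lemma curvature_balanced:
  assumes x: "x \<in> D"
  shows "gauss_curvature (induced_metric Neg f) x = L0 \<longleftrightarrow> balanced_at x"
proof -
  have "pinner Neg (Hopf 1 x) (Hopf (- 1) x) = 4 * (pinner Neg (\<alpha> x) (\<alpha> x) - pinner Neg (\<beta> x) (\<beta> x))"
    using pinner_commute[of Neg "\<alpha> x" "\<beta> x"] by (simp add: Hopf_second_ff[OF x] pinner_simps)
  then show ?thesis
    unfolding Gauss[OF x] balanced_at_def by auto
qed

text \<open>The only step that needs the hypothesis on an open set. Codazzi makes \<open>A\<^sub>+\<close> constant along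
  \<open>\<partial>\<^sub>-\<close> and \<open>A\<^sub>-\<close> constant along \<open>\<partial>\<^sub>+\<close>, as vectors of the ambient space, so repeated
  differentiation of \<open>\<langle>A\<^sub>+, A\<^sub>-\<rangle> = 0\<close> yields the hypotheses of \<open>lorentz_plane_parallel\<close> for the
  normal components of \<open>A\<^sub>+\<close>, \<open>A\<^sub>-\<close>, \<open>P = \<partial>\<^sub>+ A\<^sub>+\<close> and \<open>Q = \<partial>\<^sub>- A\<^sub>-\<close>.\<close>

lemma constant_curvature_parallel:
  assumes K: "\<And>y. y \<in> D \<Longrightarrow> gauss_curvature (induced_metric Neg f) y = L0" and x: "x \<in> D"
  shows "parallel_at x"
proof -
  let ?A = "Hopf 1" and ?B = "Hopf (- 1)"
  let ?P = "null_deriv 1 ?A" and ?Q = "null_deriv (- 1) ?B"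
  have sm: "smooth_on D ?P" "smooth_on D ?Q" "smooth_on D (D_null s)" for s
    using open_D smooth_Hopf f by (auto intro: smooth_on_null_deriv)
  have const: "null_deriv (- 1) ?A y = 0" "null_deriv 1 ?B y = 0" if "y \<in> D" for y
    using Codazzi[OF that, of 1] Codazzi[OF that, of "- 1"] K[OF that] by simp_all
  have AB: "pinner Neg (?A y) (?B y) = 0" if "y \<in> D" for y
    using Gauss[OF that] K[OF that] by simp
  have PB: "pinner Neg (?P y) (?B y) = 0" if "y \<in> D" for y
    using pinner_null_deriv_zero[OF smooth_Hopf smooth_Hopf that AB, of 1] const[OF that] by simp
  have AQ: "pinner Neg (?A y) (?Q y) = 0" if "y \<in> D" for y
    using pinner_null_deriv_zero[OF smooth_Hopf smooth_Hopf that AB, of "- 1"] const[OF that] by simp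
  have "null_deriv (- 1) ?P x = null_deriv 1 (null_deriv (- 1) ?A) x"
    by (rule null_deriv_commute[OF open_D x smooth_Hopf])
  also have "\<dots> = null_deriv 1 (\<lambda>y. 0) x"
    by (rule null_deriv_cong_open[OF open_D x const(1)])
  finally have PQ: "pinner Neg (?P x) (?Q x) = 0"
    using pinner_null_deriv_zero[OF sm(1) smooth_Hopf x PB, of "- 1"] by simp
  have tangential: "pinner Neg (null_deriv s (Hopf s) x) (D_null s x) = - pinner Neg (Hopf s x)
      (Hopf s x)"
    "pinner Neg (null_deriv s (Hopf s) x) (D_null (- s) x) = 0"
    "L0 * pinner Neg (null_deriv s (Hopf s) x) (f x) = 0" if s: "s * s = 1" for s
  proof -
    have n: "pinner Neg (Hopf s y) (D_null t y) = 0" if "y \<in> D" for y t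
      using Hopf_normal[OF that s] by (simp add: null_deriv_def[of t f] pinner_simps)
    have "null_deriv s (D_null s) x = Hopf s x + (2 * null_deriv s l x) *\<^sub>R D_null s x"
      by (simp add: Hopf_def)
    then have "pinner Neg (Hopf s x) (null_deriv s (D_null s) x) = pinner Neg (Hopf s x) (Hopf s x)"
      by (simp add: pinner_simps n[OF x])
    with pinner_null_deriv_zero[OF smooth_Hopf sm(3)[of s] x n, of s]
    show "pinner Neg (null_deriv s (Hopf s) x) (D_null s x) = - pinner Neg (Hopf s x) (Hopf s x)"
      by linarith
    have "pinner Neg (Hopf s x) (null_deriv s (D_null (- s)) x) = 0"
      using Hopf_normal(3)[OF x s] by (auto simp: wave_equation[OF x s] pinner_simps)
    with pinner_null_deriv_zero[OF smooth_Hopf sm(3)[of "- s"] x n, of s]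
    show "pinner Neg (null_deriv s (Hopf s) x) (D_null (- s) x) = 0" by simp
    have "L0 * (pinner Neg (pd i (Hopf s) x) (f x) + pinner Neg (Hopf s x) (pd i f x)) = 0" for i
      by (rule scaled_pinner_pd_zero[OF smooth_Hopf f x Hopf_normal(3)[OF _ s]])
    from this[of 1] this[of 2]
    have "L0 * pinner Neg (pd 1 (Hopf s) x) (f x) = 0" "L0 * pinner Neg (pd 2 (Hopf s) x) (f x) = 0"
      using Hopf_normal[OF x s] by simp_all
    then show "L0 * pinner Neg (null_deriv s (Hopf s) x) (f x) = 0"
      by (auto simp: null_deriv_def[of s "Hopf s"] pinner_simps)
  qed
  have P12: "2 * pinner Neg (?P x) (pd 1 f x) = - pinner Neg (?A x) (?A x)"
      "2 * pinner Neg (?P x) (pd 2 f x) = - pinner Neg (?A x) (?A x)"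
    using tangential(1,2)[of 1] by (simp_all add: null_deriv_def[of _ f] pinner_simps)
  have Q12: "2 * pinner Neg (?Q x) (pd 1 f x) = - pinner Neg (?B x) (?B x)"
      "2 * pinner Neg (?Q x) (pd 2 f x) = pinner Neg (?B x) (?B x)"
    using tangential(1,2)[of "- 1"] by (simp_all add: null_deriv_def[of _ f] pinner_simps)
  obtain n m where nm: "normal_pair_at x n m" using ex_normal_pair_at[OF x] by blast
  interpret timelike_plane L0 Neg idx "f x" "pd 1 f x" "pd 2 f x" "E x"
      by (rule timelike_plane_at[OF x])
  have NA: "pinner Neg (?A x) w = pinner Neg (?A x) n * pinner Neg w n
      - pinner Neg (?A x) m * pinner Neg w m" for w
    by (rule normal_products[OF x nm Hopf_normal[OF x]]) simp_all
  have NB: "pinner Neg (?B x) w = pinner Neg (?B x) n * pinner Neg w n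
      - pinner Neg (?B x) m * pinner Neg w m" for w
    by (rule normal_products[OF x nm Hopf_normal[OF x]]) simp_all
  have "pinner Neg (?A x) (?A x) * pinner Neg (?B x) (?B x) / (2 * E x)
      + (pinner Neg (?P x) n * pinner Neg (?Q x) n - pinner Neg (?P x) m * pinner Neg (?Q x) m) = 0"
  proof -
    have tang: "pinner Neg (?P x) (pd 1 f x) * pinner Neg (?Q x) (pd 1 f x)
       - pinner Neg (?P x) (pd 2 f x) * pinner Neg (?Q x) (pd 2 f x)
     = pinner Neg (?A x) (?A x) * pinner Neg (?B x) (?B x) / 2"
      using P12 Q12 by algebra
    have "L0 * pinner Neg (?P x) (f x) = 0" by (rule tangential(3)) simp
    from PQ[unfolded normal_pair_parseval[OF nm, of "?P x" "?Q x"] tang this] show ?thesis by simp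
  qed
  then have "pinner Neg (?A x) n * pinner Neg (?B x) m = pinner Neg (?A x) m * pinner Neg (?B x) n"
    unfolding NA[of "?A x"] NB[of "?B x"] power2_eq_square[symmetric]
    using NA[of "?B x"] NA[of "?Q x"] NB[of "?P x"] AB[OF x] AQ[OF x] PB[OF x]
      pinner_commute[of Neg "?P x" "?B x"]
    by (intro lorentz_plane_parallel[of "E x"]) (auto simp: mult.commute)
  then show ?thesis
    unfolding parallel_at_frame[OF x nm]
    by (simp add: Hopf_second_ff[OF x] pinner_simps algebra_simps)
qed

section \<open>The quartic differential and the normal curvature\<close>

lemma quartic_coeff_eq:
  assumes x: "x \<in> D"
  shows "quartic_coeff L0 Neg f x = Para ((pinner Neg (\<alpha> x) (\<alpha> x) + pinner Neg (\<beta> x) (\<beta> x)) / 4)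
    (pinner Neg (\<alpha> x) (\<beta> x) / 2)"
proof -
  have re_sum: "para_re (\<Sum>i\<in>S. g i) = (\<Sum>i\<in>S. para_re (g i))"
    and im_sum: "para_im (\<Sum>i\<in>S. g i) = (\<Sum>i\<in>S. para_im (g i))" for S :: "'n set" and g
    by (induction S rule: infinite_finite_induct) (simp_all add: zero_paracomplex_def
        plus_paracomplex_def)
  have R: "of_real r = Para r 0" for r
    by (simp add: of_real_def scaleR_paracomplex_def one_paracomplex_def)
  have sw: "sigma_ww L0 Neg f x $ k = Para (\<alpha> x $ k / 2) (\<beta> x $ k / 2)" for k
    unfolding sigma_ww_def sum_2 vec_lambda_beta del_w_def second_ff_11_22[OF x] second_ff_21[OF x]
    by (simp add: R para_j_def times_paracomplex_def plus_paracomplex_def)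
  have sgn: "(if k \<in> Neg then - 1 else 1) = Para (if k \<in> Neg then - 1 else 1) 0" for k
    by (simp add: one_paracomplex_def uminus_paracomplex_def)
  show ?thesis
    unfolding quartic_coeff_def para_pinner_def sw sgn
    by (rule paracomplex.expand)
      (auto simp: re_sum im_sum times_paracomplex_def pinner_def sum_divide_distrib
        sum.distrib[symmetric] algebra_simps intro!: sum.cong)
qed

lemma quartic_null:
  assumes x: "x \<in> D"
  shows "quartic_coeff L0 Neg f x = 0 \<or> para_null (quartic_coeff L0 Neg f x) \<longleftrightarrow>
    (pinner Neg (\<alpha> x) (\<alpha> x) + pinner Neg (\<beta> x) (\<beta> x))\<^sup>2 = 4 * (pinner Neg (\<alpha> x) (\<beta> x))\<^sup>2"
proof -
  have "q = 0 \<or> para_null q \<longleftrightarrow> para_sqnorm q = 0" for q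
    by (auto simp: para_null_def para_sqnorm_def zero_paracomplex_def)
  then show ?thesis
    by (simp add: quartic_coeff_eq[OF x] para_sqnorm_def power_divide mult.commute)
qed

lemma nabla_perp_eq:
  assumes x: "x \<in> D"
  shows "nabla_perp L0 Neg f \<xi> i x = nproj x (pd i \<xi> x)"
  unfolding nabla_perp_def nabla_def normal_part_eq[OF x] pd_def[symmetric] ..

lemma normal_pinner_nproj:
  assumes x: "x \<in> D"
    and "pinner Neg \<xi> (pd 1 f x) = 0" "pinner Neg \<xi> (pd 2 f x) = 0" "L0 * pinner Neg \<xi> (f x) = 0"
  shows "pinner Neg \<xi> (nproj x v) = pinner Neg \<xi> v"
  using assms(2-) by (auto simp: nproj_def pinner_simps)

text \<open>The first covariant derivative is \<open>\<partial>\<^sub>j \<xi>\<close> corrected by multiples of \<open>f\<^sub>u\<close> and \<open>f\<^sub>v\<close>. In the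
  second one, the derivatives of these coefficients multiply tangent vectors, which the projection
  removes, and the second derivatives of \<open>f\<close> project to the second fundamental form.\<close>

lemma nabla_perp_iterate:
  assumes x: "x \<in> D" and \<xi>: "normal_section L0 Neg D f \<xi>"
  shows "nabla_perp L0 Neg f (nabla_perp L0 Neg f \<xi> j) i x =
    nproj x (pd i (pd j \<xi>) x) + (pinner Neg (\<xi> x) (second_ff L0 Neg f j 1 x) / E x) *\<^sub>R second_ff
        L0 Neg f i 1 x
      - (pinner Neg (\<xi> x) (second_ff L0 Neg f j 2 x) / E x) *\<^sub>R second_ff L0 Neg f i 2 x"
proof -
  have sm: "smooth_on D \<xi>" and n: "\<And>y k. y \<in> D \<Longrightarrow> pinner Neg (\<xi> y) (pd k f y) = 0"
    and L: "\<And>y. y \<in> D \<Longrightarrow> L0 * pinner Neg (\<xi> y) (f y) = 0"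
    using \<xi> by (auto simp: normal_section_def tangent_space_iff)
  define c where "c k y = pinner Neg (\<xi> y) (pd j (pd k f) y) / E y" for k y
  have Z: "nabla_perp L0 Neg f \<xi> j y = (pd j \<xi> y + c 1 y *\<^sub>R pd 1 f y) - c 2 y *\<^sub>R pd 2 f y" if y:
      "y \<in> D" for y
  proof -
    have "pinner Neg (pd j \<xi> y) (pd k f y) = - pinner Neg (\<xi> y) (pd j (pd k f) y)" for k
      using scaled_pinner_pd_zero[OF sm smooth_on_pd[OF f] y, of 1 k 0 j] n by simp
    moreover have "L0 * pinner Neg (pd j \<xi> y) (f y) = 0"
      using scaled_pinner_pd_zero[OF sm f y L, of j] n[OF y] by simp
    ultimately show ?thesis by (simp add: nabla_perp_eq[OF y] nproj_def c_def)
  qed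
  have dc: "c k differentiable at x" for k
    unfolding c_def using x
    by (intro differentiable_divide differentiable_bilinear[OF bounded_bilinear_pinner])
      (auto intro: smooth_on_differentiable sm smooth_on_pd f smooth_E)
  have df2: "(\<lambda>y. c k y *\<^sub>R pd k f y) differentiable at x" for k
    by (rule differentiable_bilinear[OF bounded_bilinear_scaleR dc dpf[OF x]])
  have dx: "pd j \<xi> differentiable at x" using sm x by (auto intro: smooth_on_differentiable
      smooth_on_pd)
  have "pd i (nabla_perp L0 Neg f \<xi> j) x = pd i (\<lambda>y. (pd j \<xi> y + c 1 y *\<^sub>R pd 1 f y)
      - c 2 y *\<^sub>R pd 2 f y) x"
    by (rule pd_cong_open[OF open_D x Z])
  also have "\<dots> = pd i (pd j \<xi>) x + pd i (\<lambda>y. c 1 y *\<^sub>R pd 1 f y) x - pd i (\<lambda>y. c 2 y *\<^sub>R pd 2 f y) x"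
    by (simp add: pd_diff pd_add df2 dx)
  finally have "nabla_perp L0 Neg f (nabla_perp L0 Neg f \<xi> j) i x =
    nproj x (pd i (pd j \<xi>) x) + c 1 x *\<^sub>R second_ff L0 Neg f i 1 x - c 2 x *\<^sub>R second_ff L0 Neg f i 2 x"
    by (simp add: nabla_perp_eq[OF x] pd_bilinear[OF bounded_bilinear_scaleR dc dpf[OF x]]
        nproj_linear nproj_tangent[OF x] second_ff_eq[OF x])
  moreover have "c k x = pinner Neg (\<xi> x) (second_ff L0 Neg f j k x) / E x" for k
    using normal_pinner_nproj[OF x n[OF x] n[OF x] L[OF x]] by (simp add: c_def second_ff_eq[OF x])
  ultimately show ?thesis by simp
qed

text \<open>The Ricci equation for a minimal surface; the ambient curvature does not contribute in a
  space form.\<close>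

lemma normal_curvature_eq:
  assumes x: "x \<in> D" and \<xi>: "normal_section L0 Neg D f \<xi>"
  shows "normal_curvature L0 Neg f 1 2 \<xi> x =
    (2 / E x) *\<^sub>R (pinner Neg (\<xi> x) (\<beta> x) *\<^sub>R \<alpha> x - pinner Neg (\<xi> x) (\<alpha> x) *\<^sub>R \<beta> x)"
proof -
  have sm: "smooth_on D \<xi>" using \<xi> by (simp add: normal_section_def)
  show ?thesis
    unfolding normal_curvature_def nabla_perp_iterate[OF x \<xi>] second_ff_11_22[OF x] second_ff_21[OF x]
      pd_commute[OF open_D x sm, of 2 1]
    by (simp add: scaleR_diff_right scaleR_2[symmetric] algebra_simps)
qed

lemma flat_normal_iff:
  "(\<forall>\<xi>. normal_section L0 Neg D f \<xi> \<longrightarrow> (\<forall>x\<in>D. \<forall>i j. normal_curvature L0 Neg f i j \<xi> x = 0))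
    \<longleftrightarrow> (\<forall>x\<in>D. parallel_at x)"
proof (intro iffI ballI allI impI)
  fix \<xi> x i j
  assume par: "\<forall>x\<in>D. parallel_at x" and \<xi>: "normal_section L0 Neg D f \<xi>" and x: "x \<in> D"
  obtain n m where nm: "normal_pair_at x n m" using ex_normal_pair_at[OF x] by blast
  have xin: "pinner Neg (\<xi> x) (pd 1 f x) = 0" "pinner Neg (\<xi> x) (pd 2 f x) = 0" "L0
      * pinner Neg (\<xi> x) (f x) = 0"
    using \<xi> x by (auto simp: normal_section_def tangent_space_iff)
  let ?v = "pinner Neg (\<xi> x) (\<beta> x) *\<^sub>R \<alpha> x - pinner Neg (\<xi> x) (\<alpha> x) *\<^sub>R \<beta> x"
  have W: "pinner Neg (\<alpha> x) n * pinner Neg (\<beta> x) m = pinner Neg (\<alpha> x) m * pinner Neg (\<beta> x) n"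
    using par x parallel_at_frame[OF x nm] by blast
  note P = normal_products[OF x nm xin]
  have "?v = 0"
  proof (rule normal_zero[OF x nm])
    show "pinner Neg ?v n = 0" "pinner Neg ?v m = 0"
      unfolding pinner_simps P[of "\<alpha> x"] P[of "\<beta> x"] using W by algebra+
    show "L0 * pinner Neg ?v (f x) = 0"
      using second_ff_normal(3)[OF x, of 1 1] second_ff_normal(3)[OF x, of 1 2]
          by (auto simp: pinner_simps)
  qed (simp_all add: pinner_simps second_ff_normal[OF x])
  then have R: "normal_curvature L0 Neg f 1 2 \<xi> x = 0" by (simp add: normal_curvature_eq[OF x \<xi>])
  then have "normal_curvature L0 Neg f 2 1 \<xi> x = 0" by (simp add: normal_curvature_def)
  moreover have "normal_curvature L0 Neg f i i \<xi> x = 0" for i by (simp add: normal_curvature_def)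
  ultimately show "normal_curvature L0 Neg f i j \<xi> x = 0"
    using R exhaust_2[of i] exhaust_2[of j] by auto
next
  fix x assume flat: "\<forall>\<xi>. normal_section L0 Neg D f \<xi> \<longrightarrow> (\<forall>x\<in>D. \<forall>i j. normal_curvature L0 Neg f i j
      \<xi> x = 0)"
    and x: "x \<in> D"
  obtain n m where nm: "normal_pair_at x n m" using ex_normal_pair_at[OF x] by blast
  \<comment> \<open>A normal section on all of \<open>D\<close> that is a multiple of \<open>n\<close> at \<open>x\<close>: the projection of the
    constant vector \<open>n\<close>, times \<open>E\<close> to clear the denominators, so that smoothness is immediate.\<close>
  define \<xi> where "\<xi> y = ((E y *\<^sub>R n - pinner Neg n (pd 1 f y) *\<^sub>R pd 1 f y) + pinner Neg n
      (pd 2 f y) *\<^sub>R pd 2 f y)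
     - (E y *\<^sub>R (L0 *\<^sub>R pinner Neg n (f y))) *\<^sub>R f y" for y
  have \<xi>: "\<xi> y = E y *\<^sub>R nproj y n" for y
    by (simp add: \<xi>_def nproj_def algebra_simps)
  have "smooth_on D \<xi>"
    unfolding \<xi>_def[abs_def]
    by (intro smooth_on_add smooth_on_diff smooth_on_scaleR smooth_on_const smooth_on_pd f open_D
        smooth_E smooth_on_bilinear[OF bounded_bilinear_pinner])
  moreover have "pinner Neg (\<xi> y) (pd i f y) = 0" "L0 * pinner Neg (\<xi> y) (f y) = 0" if "y \<in> D" for y i
    using nproj_normal[OF that, of n] exhaust_2[of i] by (auto simp: \<xi> pinner_simps)
  ultimately have sec: "normal_section L0 Neg D f \<xi>"
    by (auto simp: normal_section_def tangent_space_iff)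
  have n: "pinner Neg n (pd 1 f x) = 0" "pinner Neg n (pd 2 f x) = 0" "L0 * pinner Neg n (f x) = 0"
    using nm by (auto simp: normal_pair_def tangent_space_iff)
  have "\<xi> x = E x *\<^sub>R n" using nproj_id[OF n] by (simp add: \<xi>)
  moreover have "normal_curvature L0 Neg f 1 2 \<xi> x = 0" using flat sec x by blast
  ultimately have "pinner Neg n (\<beta> x) *\<^sub>R \<alpha> x = pinner Neg n (\<alpha> x) *\<^sub>R \<beta> x"
    by (simp add: normal_curvature_eq[OF x sec] pinner_simps flip: scaleR_scaleR)
  then have "pinner Neg n (\<beta> x) * pinner Neg (\<alpha> x) m = pinner Neg n (\<alpha> x) * pinner Neg (\<beta> x) m"
    by (metis pinner_scaleR_left)
  then show "parallel_at x"
    unfolding parallel_at_frame[OF x nm] by (simp add: pinner_commute[of Neg n] mult.commute)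
qed

end

section \<open>The derivative of the twistor lifts\<close>

lemma bivector_inner_commute: "bivector_inner Neg A B = bivector_inner Neg B A"
  unfolding bivector_inner_def by (simp add: mult_ac)

lemma bivector_inner_add_left:
  "bivector_inner Neg (A + B) C = bivector_inner Neg A C + bivector_inner Neg B C"
  by (simp add: bivector_inner_def sum.distrib distrib_left distrib_right add_divide_distrib)

lemma bivector_inner_scaleR_left: "bivector_inner Neg (c *\<^sub>R A) C = c * bivector_inner Neg A C"
  by (simp add: bivector_inner_def sum_distrib_left mult_ac)

lemma bivector_inner_add_right:
  "bivector_inner Neg C (A + B) = bivector_inner Neg C A + bivector_inner Neg C B"
  by (simp add: bivector_inner_commute[of Neg C] bivector_inner_add_left)

lemma bivector_inner_scaleR_right: "bivector_inner Neg C (c *\<^sub>R A) = c * bivector_inner Neg C A"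
  by (simp add: bivector_inner_commute[of Neg C] bivector_inner_scaleR_left)

lemma bivector_proj_scaleR: "bivector_proj L0 Neg x (c *\<^sub>R A) = c *\<^sub>R bivector_proj L0 Neg x A"
  by (simp add: bivector_proj_def Let_def matrix_matrix_mult_def vec_eq_iff sum_distrib_left
      sum_distrib_right mult_ac)

text \<open>The derivatives of a pseudo-orthonormal frame, expanded with skew-symmetric connection
  coefficients. The coefficients \<open>t\<close> and \<open>z\<close> of the tangent and of the normal plane cancel because
  \<open>e1 \<and> e3\<close> and \<open>m \<and> n\<close> are invariant under the Lorentz rotations of these planes.\<close>

lemma moving_frame_norm:
  fixes e1 n e3 m :: "real^'n::finite"
  assumes "pinner Neg e1 e1 = 1" "pinner Neg n n = 1" "pinner Neg e3 e3 = -1" "pinner Neg m m = -1"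
    and "pinner Neg e1 n = 0" "pinner Neg e1 e3 = 0" "pinner Neg e1 m = 0"
      "pinner Neg n e3 = 0" "pinner Neg n m = 0" "pinner Neg e3 m = 0"
    and d: "d1 = p *\<^sub>R n - t *\<^sub>R e3 - q *\<^sub>R m" "d3 = r *\<^sub>R n - t *\<^sub>R e1 - w *\<^sub>R m"
      "dn = r *\<^sub>R e3 - p *\<^sub>R e1 - z *\<^sub>R m" "dm = w *\<^sub>R e3 - q *\<^sub>R e1 - z *\<^sub>R n"
    and s: "s * s = 1"
    and T: "T = (1 / sqrt 2) *\<^sub>R ((bivector d1 e3 + bivector e1 d3) + s *\<^sub>R (bivector dm n
        + bivector m dn))"
  shows "bivector_inner Neg T T = (r - s * q)\<^sup>2 - (p - s * w)\<^sup>2"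
proof -
  \<comment> \<open>The four mixed components of the derivative. They agree in pairs up to \<open>s\<close>, since the
    derivative is again (anti-)self-dual.\<close>
  define a b c d where abcd: "a = r - s * q" "b = p - s * w" "c = s * r - q" "d = s * p - w"
  have T': "T = (1 / sqrt 2) *\<^sub>R (a *\<^sub>R bivector e1 n + b *\<^sub>R bivector n e3 + c *\<^sub>R bivector m e3
      + d *\<^sub>R bivector e1 m)"
    unfolding T d abcd by (simp add: bivector_def vec_eq_iff algebra_simps)
  have comm: "pinner Neg n e1 = 0" "pinner Neg e3 e1 = 0" "pinner Neg m e1 = 0"
      "pinner Neg e3 n = 0" "pinner Neg m n = 0" "pinner Neg m e3 = 0"
    using assms(5-10) by (simp_all add: pinner_commute)
  define k :: real where "k = 1 / sqrt 2"
  have k: "k * k = 1 / 2" by (simp add: k_def)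
  have "bivector_inner Neg T T = k * k * (a * a - b * b + c * c - d * d)"
    unfolding T' k_def[symmetric]
    by (simp add: bivector_inner_add_left bivector_inner_add_right bivector_inner_scaleR_left
        bivector_inner_scaleR_right bivector_inner_bivector assms(1-10) comm algebra_simps)
  then have "bivector_inner Neg T T = (a\<^sup>2 - b\<^sup>2 + c\<^sup>2 - d\<^sup>2) / 2"
    unfolding k power2_eq_square by simp
  moreover have "c = s * a" "d = s * b"
    using s by (simp_all add: abcd algebra_simps flip: mult.assoc)
  moreover have "s\<^sup>2 = 1" using s by (simp add: power2_eq_square)
  ultimately show ?thesis by (simp add: power_mult_distrib abcd)
qed

lemma frechet_derivative_pd:
  assumes "h differentiable at x"
  shows "frechet_derivative h (at x) V = V $ 1 *\<^sub>R pd 1 h x + V $ 2 *\<^sub>R pd 2 h x"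
proof -
  have lin: "linear (frechet_derivative h (at x))" by (rule linear_frechet_derivative[OF assms])
  have "V = V $ 1 *\<^sub>R axis 1 1 + V $ 2 *\<^sub>R axis 2 1"
    by (simp add: vec_eq_iff forall_2 axis_def)
  then have "frechet_derivative h (at x) V = frechet_derivative h (at x) (V $ 1 *\<^sub>R axis 1 1
      + V $ 2 *\<^sub>R axis 2 1)"
    by simp
  then show ?thesis by (simp add: linear_add[OF lin] linear_scale[OF lin] pd_def)
qed

lemma pinner_frechet_derivative_const:
  fixes X Y :: "real^2 \<Rightarrow> real^'n::finite"
  assumes X: "X differentiable at x" and Y: "Y differentiable at x" and U: "open U" "x \<in> U"
    and c: "\<And>y. y \<in> U \<Longrightarrow> pinner Neg (X y) (Y y) = c"
  shows "pinner Neg (frechet_derivative X (at x) V) (Y x) + pinner Neg (X x) (frechet_derivative Y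
      (at x) V) = 0"
proof -
  have "pd i (\<lambda>y. pinner Neg (X y) (Y y)) x = 0" for i
    using pd_cong_open[OF U c] by simp
  then have 0: "pinner Neg (pd i X x) (Y x) + pinner Neg (X x) (pd i Y x) = 0" for i
    by (simp add: pd_pinner X Y)
  show ?thesis
    unfolding frechet_derivative_pd[OF X] frechet_derivative_pd[OF Y] pinner_simps
    using 0[of 1] 0[of 2] by algebra
qed

lemma differentiable_inverse_sqrt:
  fixes q :: "'a::real_normed_vector \<Rightarrow> real"
  assumes "q differentiable at x" "q x > 0"
  shows "(\<lambda>y. 1 / sqrt (q y)) differentiable at x"
proof -
  obtain q' where "(q has_derivative q') (at x)" using assms(1) by (auto simp: differentiable_def)
  from has_derivative_real_sqrt[OF assms(2) this]
  have "(\<lambda>y. sqrt (q y)) differentiable at x" by (auto simp: differentiable_def)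
  then show ?thesis using assms(2) by (intro differentiable_divide) auto
qed

lemma isCont_det:
  fixes M :: "'a::t2_space \<Rightarrow> real^'n^'n"
  assumes "\<And>i. isCont (\<lambda>y. M y $ i) x"
  shows "isCont (\<lambda>y. det (M y)) x"
proof -
  have "isCont (\<lambda>y. M y $ i $ j) x" for i j by (intro isCont_vec_nth assms)
  then show ?thesis unfolding det_def by (intro isCont_sum isCont_mult continuous_prod
      continuous_const ballI)
qed

lemma eventually_nhds_pos:
  fixes h :: "'a::t2_space \<Rightarrow> real"
  assumes "isCont h x" "h x > 0"
  shows "\<forall>\<^sub>F y in nhds x. h y > 0"
  using assms order_tendstoD(1)[of h "h x" "at x" 0] by (simp add: eventually_nhds_conv_at isCont_def)

lemma nabla_hat_combination:
  fixes B C :: "real^2 \<Rightarrow> real^'n::finite^'n"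
  assumes "B differentiable at x" "C differentiable at x"
  shows "nabla_hat L0 Neg f (\<lambda>y. c *\<^sub>R (B y + s *\<^sub>R C y)) V x =
    c *\<^sub>R (nabla_hat L0 Neg f B V x + s *\<^sub>R nabla_hat L0 Neg f C V x)"
proof -
  have "((\<lambda>y. c *\<^sub>R (B y + s *\<^sub>R C y)) has_derivative
      (\<lambda>h. c *\<^sub>R (frechet_derivative B (at x) h + s *\<^sub>R frechet_derivative C (at x) h))) (at x)"
    using assms unfolding frechet_derivative_works by (intro derivative_intros)
  note D = frechet_derivative_at[OF this, symmetric]
  show ?thesis
    unfolding nabla_hat_def D bivector_proj_scaleR bivector_proj_add ..
qed

context timelike_patch
begin

abbreviation e1 :: "real^2 \<Rightarrow> real^'n" where "e1 y \<equiv> exp (- l y) *\<^sub>R pd 1 f y"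
abbreviation e3 :: "real^2 \<Rightarrow> real^'n" where "e3 y \<equiv> exp (- l y) *\<^sub>R pd 2 f y"

lemma exp_l_square: "exp (- l x) * (exp (- l x) * E x) = 1"
  by (simp add: mult_exp_exp)

text \<open>Any positive normal pair completes the normalised coordinate frame to an adapted frame, and
  the value does not depend on the adapted frame: \<open>u1 \<and> u3\<close> is determined by area and orientation,
  and \<open>u4 \<and> u2\<close> by \<open>positive_normal_pair_bivector\<close>.\<close>

lemma twistor_lift_eq:
  assumes x: "x \<in> D" and nm: "normal_pair_at x n m" "positive_frame L0 idx
      (f x) [pd 1 f x, n, pd 2 f x, m]"
  shows "twistor_lift L0 Neg idx f s x = (1 / sqrt 2) *\<^sub>R (bivector (e1 x) (e3 x) + s *\<^sub>R bivector m n)"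
proof -
  interpret timelike_plane L0 Neg idx "f x" "pd 1 f x" "pd 2 f x" "E x"
      by (rule timelike_plane_at[OF x])
  note P = normal_pair_products[OF nm(1)]
  have e13: "bivector (e1 x) (e3 x) = (1 / E x) *\<^sub>R bivector (pd 1 f x) (pd 2 f x)"
  proof -
    have "exp (- l x) * exp (- l x) = 1 / E x" by (simp add: mult_exp_exp exp_minus field_simps)
    then show ?thesis using bivector_combination[of "exp (- l x)" "pd 1 f x" 0 "pd 2 f x" 0 "exp
        (- l x)"] by simp
  qed
  have adapted: "adapted_frame L0 Neg idx f x (e1 x) n (e3 x) m"
    unfolding adapted_frame_def
  proof (intro conjI)
    show "{e1 x, n, e3 x, m} \<subseteq> tangent_space L0 Neg (f x)"
      using nm(1) position_tangent[OF x] by (auto simp: normal_pair_def tangent_space_iff pinner_simps)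
    show "\<exists>a b c d. e1 x = a *\<^sub>R pd 1 f x + b *\<^sub>R pd 2 f x \<and> e3 x = c *\<^sub>R pd 1 f x
        + d *\<^sub>R pd 2 f x \<and> a * d - b * c > 0"
      by (rule exI[of _ "exp (- l x)"], rule exI[of _ 0], rule exI[of _ 0], rule exI[of _ "exp
          (- l x)"]) simp
    show "positive_frame L0 idx (f x) [e1 x, n, e3 x, m]"
      using nm(2) det_row_tangent[of "exp (- l x)" "pd 1 f x" 0 "pd 2 f x" n 0 "exp (- l x)" m]
      by (simp add: positive_frame_iff)
  qed (simp_all add: pinner_simps P timelike_plane.metric[OF timelike_plane_at[OF x]] exp_l_square)
  have unique: "bivector u1 u3 + s *\<^sub>R bivector u4 u2 = bivector (e1 x) (e3 x) + s *\<^sub>R bivector m n"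
    if u: "adapted_frame L0 Neg idx f x u1 u2 u3 u4" for u1 u2 u3 u4
  proof -
    obtain a b c d where abcd: "u1 = a *\<^sub>R pd 1 f x + b *\<^sub>R pd 2 f x" "u3 = c *\<^sub>R pd 1 f x
        + d *\<^sub>R pd 2 f x"
      "a * d - b * c > 0"
      using u unfolding adapted_frame_def by blast
    have o: "pinner Neg u1 u1 = 1" "pinner Neg u3 u3 = -1" "pinner Neg u1 u3 = 0"
      "pinner Neg u2 u1 = 0" "pinner Neg u2 u3 = 0" "pinner Neg u4 u1 = 0" "pinner Neg u4 u3 = 0"
      "pinner Neg u2 u2 = 1" "pinner Neg u4 u4 = -1" "pinner Neg u2 u4 = 0"
      and pos: "positive_frame L0 idx (f x) [u1, u2, u3, u4]"
      and tan: "u2 \<in> tangent_space L0 Neg (f x)" "u4 \<in> tangent_space L0 Neg (f x)"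
      using u unfolding adapted_frame_def by (auto simp: pinner_commute)
    have m: "pinner Neg (pd 1 f x) (pd 1 f x) = E x" "pinner Neg (pd 1 f x) (pd 2 f x) = 0"
      "pinner Neg (pd 2 f x) (pd 1 f x) = 0" "pinner Neg (pd 2 f x) (pd 2 f x) = - E x"
      using timelike_plane.metric[OF timelike_plane_at[OF x]] ts by simp_all
    have "(a * a - b * b) * E x = 1" "(c * c - d * d) * E x = -1" "(a * c - b * d) * E x = 0"
      using o(1-3) by (simp_all add: abcd(1,2) pinner_simps m algebra_simps)
    then have "((a * d - b * c) * E x)\<^sup>2 = 1" by algebra
    then have "(a * d - b * c) * E x = 1"
      using abcd(3) by (auto simp: power2_eq_1_iff) (smt (verit) mult_pos_pos exp_gt_zero)
    then have "a * d - b * c = 1 / E x" by (simp add: field_simps)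
    then have b13: "bivector u1 u3 = bivector (e1 x) (e3 x)"
      by (simp add: abcd(1,2) bivector_combination e13)
    have normal: "pinner Neg v (pd 1 f x) = 0 \<and> pinner Neg v (pd 2 f x) = 0"
      if "pinner Neg v u1 = 0" "pinner Neg v u3 = 0" for v
    proof -
      have 1: "a * pinner Neg v (pd 1 f x) + b * pinner Neg v (pd 2 f x) = 0"
        "c * pinner Neg v (pd 1 f x) + d * pinner Neg v (pd 2 f x) = 0"
        using that by (simp_all add: abcd(1,2) pinner_simps)
      then have "(a * d - b * c) * pinner Neg v (pd 1 f x) = 0" "(a * d - b * c) * pinner Neg v
          (pd 2 f x) = 0"
        by algebra+
      then show ?thesis using abcd(3) by simp
    qed
    have pair: "normal_pair_at x u2 u4"
      using o tan normal[of u2] normal[of u4] by (simp add: normal_pair_def)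
    have "positive_frame L0 idx (f x) [pd 1 f x, u2, pd 2 f x, u4]"
      using pos abcd(3) unfolding positive_frame_iff abcd(1,2) det_row_tangent
          by (simp add: zero_less_mult_iff)
    from positive_normal_pair_bivector[OF nm pair this] b13 show ?thesis by simp
  qed
  show ?thesis
    unfolding twistor_lift_def
  proof (rule the_equality)
    show "\<exists>u1 u2 u3 u4. adapted_frame L0 Neg idx f x u1 u2 u3 u4 \<and>
        (1 / sqrt 2) *\<^sub>R (bivector (e1 x) (e3 x) + s *\<^sub>R bivector m n)
        = (1 / sqrt 2) *\<^sub>R (bivector u1 u3 + s *\<^sub>R bivector u4 u2)"
      by (intro exI conjI, rule adapted, rule refl)
  next
    fix B assume "\<exists>u1 u2 u3 u4. adapted_frame L0 Neg idx f x u1 u2 u3 u4 \<and>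
        B = (1 / sqrt 2) *\<^sub>R (bivector u1 u3 + s *\<^sub>R bivector u4 u2)"
    then show "B = (1 / sqrt 2) *\<^sub>R (bivector (e1 x) (e3 x) + s *\<^sub>R bivector m n)"
      by (elim exE conjE) (simp only: unique)
  qed
qed

lemma differentiable_nproj:
  assumes x: "x \<in> D"
  shows "(\<lambda>y. nproj y v) differentiable at x"
proof -
  note bil = differentiable_bilinear[OF bounded_bilinear_pinner differentiable_const]
    differentiable_bilinear[OF bounded_bilinear_scaleR]
  show ?thesis
    unfolding nproj_def
    by (intro differentiable_add differentiable_diff differentiable_const bil differentiable_divide
        differentiable_mult dpf[OF x] df[OF x] smooth_on_differentiable[OF smooth_E x]) simp_all
qed

text \<open>The projections of the constant vectors \<open>n0\<close> and \<open>m0\<close> to the nearby normal planes, made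
  pseudo-orthonormal by the Gram-Schmidt process. The required signs of the square norms and of
  the determinant hold at \<open>x\<close> and persist nearby by continuity.\<close>

lemma moving_frame:
  assumes x: "x \<in> D" and nm: "normal_pair_at x n0 m0" "positive_frame L0 idx
      (f x) [pd 1 f x, n0, pd 2 f x, m0]"
  obtains U n m where "open U" "x \<in> U" "U \<subseteq> D" "n x = n0" "m x = m0"
    "n differentiable at x" "m differentiable at x"
    "\<And>y. y \<in> U \<Longrightarrow> normal_pair_at y (n y) (m y)"
    "\<And>y. y \<in> U \<Longrightarrow> positive_frame L0 idx (f y) [pd 1 f y, n y, pd 2 f y, m y]"
proof -
  have O: "pinner Neg n0 n0 = 1" "pinner Neg m0 m0 = -1" "pinner Neg m0 n0 = 0"
    using nm(1) by (simp_all add: normal_pair_def pinner_commute)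
  have N0: "nproj x n0 = n0" "nproj x m0 = m0"
    using nm(1) by (simp_all add: nproj_def normal_pair_def tangent_space_iff)
  define q where "q y = pinner Neg (nproj y n0) (nproj y n0)" for y
  define n where "n y = (1 / sqrt (q y)) *\<^sub>R nproj y n0" for y
  define M where "M y = nproj y m0 - pinner Neg (nproj y m0) (n y) *\<^sub>R n y" for y
  define r where "r y = pinner Neg (M y) (- M y)" for y
  define m where "m y = (1 / sqrt (r y)) *\<^sub>R M y" for y
  have qx: "q x = 1" by (simp add: q_def N0 O)
  have nx: "n x = n0" by (simp add: n_def qx N0)
  have Mx: "M x = m0" by (simp add: M_def N0 nx O)
  have rx: "r x = 1" by (simp add: r_def Mx O pinner_simps)
  have mx: "m x = m0" by (simp add: m_def rx Mx)
  note bil = differentiable_bilinear[OF bounded_bilinear_pinner] differentiable_bilinear[OF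
      bounded_bilinear_scaleR]
  have dq: "q differentiable at x" unfolding q_def[abs_def] by (intro bil differentiable_nproj[OF x])
  have dn: "n differentiable at x"
    unfolding n_def[abs_def] using qx by (intro bil differentiable_nproj[OF x]
        differentiable_inverse_sqrt[OF dq]) simp
  have dM: "M differentiable at x"
    unfolding M_def[abs_def] by (intro differentiable_diff bil differentiable_nproj[OF x] dn)
  have dr: "r differentiable at x" unfolding r_def[abs_def] by (intro bil differentiable_minus dM)
  have dm: "m differentiable at x"
    unfolding m_def[abs_def] using rx by (intro bil dM differentiable_inverse_sqrt[OF dr]) simp
  note cont = differentiable_imp_continuous_within
  let ?d = "\<lambda>y. det (\<chi> i. (if L0 = 0 then [pd 1 f y, n y, pd 2 f y, m y] else [pd 1 f y, n y, pd 2
      f y, m y] @ [f y]) ! idx i)"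
  have "isCont ?d x"
  proof (rule isCont_det)
    fix i
    interpret timelike_plane L0 Neg idx "f x" "pd 1 f x" "pd 2 f x" "E x"
        by (rule timelike_plane_at[OF x])
    have c: "isCont (pd 1 f) x" "isCont n x" "isCont (pd 2 f) x" "isCont m x" "isCont f x"
      using dn dm df[OF x] dpf[OF x] by (auto intro: cont)
    show "isCont (\<lambda>y. (\<chi> i. (if L0 = 0 then [pd 1 f y, n y, pd 2 f y, m y] else [pd 1 f y, n y, pd
        2 f y, m y] @ [f y]) ! idx i) $ i) x"
      by (rule idx_cases[of i]; cases "L0 = 0") (use c in \<open>simp_all add: numeral_eq_Suc\<close>)
  qed
  moreover have "?d x > 0" using nm(2) unfolding positive_frame_def nx mx .
  ultimately have "\<forall>\<^sub>F y in nhds x. ?d y > 0" by (rule eventually_nhds_pos)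
  moreover have "\<forall>\<^sub>F y in nhds x. q y > 0" "\<forall>\<^sub>F y in nhds x. r y > 0"
    using qx rx by (auto intro!: eventually_nhds_pos cont dq dr)
  moreover have "\<forall>\<^sub>F y in nhds x. y \<in> D" using open_D x by (rule eventually_nhds_in_open)
  ultimately have "\<forall>\<^sub>F y in nhds x. y \<in> D \<and> q y > 0 \<and> r y > 0 \<and> ?d y > 0" by eventually_elim simp
  then obtain U where U: "open U" "x \<in> U" "\<And>y. y \<in> U \<Longrightarrow> y \<in> D \<and> q y > 0 \<and> r y > 0 \<and> ?d y > 0"
    unfolding eventually_nhds by blast
  show thesis
  proof (rule that[OF U(1,2) _ nx mx dn dm])
    show "U \<subseteq> D" using U(3) by blast
    fix y assume "y \<in> U"
    then have y: "y \<in> D" "q y > 0" "r y > 0" "?d y > 0" using U(3) by auto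
    note N = nproj_normal[OF y(1)]
    have n1: "pinner Neg (n y) (n y) = 1"
      using y(2) by (simp add: n_def pinner_simps flip: q_def)
    have n2: "pinner Neg (n y) (pd 1 f y) = 0" "pinner Neg (n y) (pd 2 f y) = 0" "L0
        * pinner Neg (n y) (f y) = 0"
      using N[of n0] by (auto simp: n_def pinner_simps)
    have M2: "pinner Neg (n y) (M y) = 0" "pinner Neg (M y) (pd 1 f y) = 0" "pinner Neg (M y)
        (pd 2 f y) = 0" "L0 * pinner Neg (M y) (f y) = 0"
      using N[of m0] n1 n2 by (auto simp: M_def pinner_simps pinner_commute[of Neg "n y" "nproj y m0"])
    have "pinner Neg (M y) (M y) = - r y" by (simp add: r_def pinner_simps)
    then have "pinner Neg (m y) (m y) = -1"
      using y(3) by (simp add: m_def pinner_simps)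
    then show "normal_pair_at y (n y) (m y)"
      using n1 n2 M2 by (auto simp: normal_pair_def tangent_space_iff m_def pinner_simps)
    show "positive_frame L0 idx (f y) [pd 1 f y, n y, pd 2 f y, m y]"
      using y(4) unfolding positive_frame_def .
  qed
qed

text \<open>In an adapted moving frame the mixed connection coefficients along \<open>V\<close> are the components of
  \<open>\<sigma>(V, \<partial>\<^sub>u) = V\<^sub>1 \<alpha> + V\<^sub>2 \<beta>\<close> and \<open>\<sigma>(V, \<partial>\<^sub>v) = V\<^sub>1 \<beta> + V\<^sub>2 \<alpha>\<close>, up to the factor \<open>e\<^sup>-\<^sup>l\<close>. The
  dependence on \<open>V\<close> then factors out, because
  \<open>(V\<^sub>1 P + V\<^sub>2 R)\<^sup>2 - (V\<^sub>1 R + V\<^sub>2 P)\<^sup>2 = (V\<^sub>1\<^sup>2 - V\<^sub>2\<^sup>2) (P\<^sup>2 - R\<^sup>2)\<close>.\<close>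

lemma twistor_derivative_norm:
  assumes x: "x \<in> D" and nm: "normal_pair_at x n0 m0" "positive_frame L0 idx
      (f x) [pd 1 f x, n0, pd 2 f x, m0]"
    and s: "s * s = 1"
    and T: "T = nabla_hat L0 Neg f (twistor_lift L0 Neg idx f s) V x"
  shows "bivector_inner Neg T T = (exp (- l x))\<^sup>2 * ((V $ 1)\<^sup>2 - (V $ 2)\<^sup>2) *
    ((pinner Neg (\<beta> x) n0 - s * pinner Neg (\<alpha> x) m0)\<^sup>2 - (pinner Neg (\<alpha> x) n0 - s
        * pinner Neg (\<beta> x) m0)\<^sup>2)"
proof -
  obtain U n m where U: "open U" "x \<in> U" "U \<subseteq> D" and nm0: "n x = n0" "m x = m0"
    and d: "n differentiable at x" "m differentiable at x"
    and pair: "\<And>y. y \<in> U \<Longrightarrow> normal_pair_at y (n y) (m y)"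
    and pos: "\<And>y. y \<in> U \<Longrightarrow> positive_frame L0 idx (f y) [pd 1 f y, n y, pd 2 f y, m y]"
    by (rule moving_frame[OF x nm]) blast
  have dexp: "(\<lambda>y. exp (- l y)) differentiable at x"
    using smooth_on_differentiable[OF l x] unfolding differentiable_def
        by (auto intro!: derivative_eq_intros)
  have de: "e1 differentiable at x" "e3 differentiable at x"
    by (rule differentiable_bilinear[OF bounded_bilinear_scaleR dexp dpf[OF x]])+
  have orth: "pinner Neg (e1 y) (e1 y) = 1" "pinner Neg (e3 y) (e3 y) = -1" "pinner Neg (e1 y)
      (e3 y) = 0"
    "pinner Neg (n y) (n y) = 1" "pinner Neg (m y) (m y) = -1" "pinner Neg (n y) (m y) = 0"
    "pinner Neg (e1 y) (n y) = 0" "pinner Neg (e1 y) (m y) = 0"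
    "pinner Neg (e3 y) (n y) = 0" "pinner Neg (e3 y) (m y) = 0" if "y \<in> U" for y
  proof -
    have y: "y \<in> D" using that U by blast
    interpret timelike_plane L0 Neg idx "f y" "pd 1 f y" "pd 2 f y" "E y"
        by (rule timelike_plane_at[OF y])
    show "pinner Neg (e1 y) (e1 y) = 1" "pinner Neg (e3 y) (e3 y) = -1" "pinner Neg (e1 y) (e3 y) = 0"
      "pinner Neg (n y) (n y) = 1" "pinner Neg (m y) (m y) = -1" "pinner Neg (n y) (m y) = 0"
      "pinner Neg (e1 y) (n y) = 0" "pinner Neg (e1 y) (m y) = 0"
      "pinner Neg (e3 y) (n y) = 0" "pinner Neg (e3 y) (m y) = 0"
      by (simp_all add: pinner_simps normal_pair_products[OF pair[OF that]]
          timelike_plane.metric[OF timelike_plane_at[OF y]] exp_l_square)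
  qed
  have tan: "e1 x \<in> tangent_space L0 Neg (f x)" "e3 x \<in> tangent_space L0 Neg (f x)"
    "n x \<in> tangent_space L0 Neg (f x)" "m x \<in> tangent_space L0 Neg (f x)"
    using position_tangent[OF x] pair[OF U(2)] by (auto simp: tangent_space_iff pinner_simps
        normal_pair_def)
  let ?d = "\<lambda>X. nabla L0 Neg f X V x"
  have proj: "pinner Neg (?d X) v = pinner Neg (frechet_derivative X (at x) V) v"
    if "v \<in> tangent_space L0 Neg (f x)" for X v
    using that by (auto simp: nabla_def tangent_proj_def pinner_simps tangent_space_iff
        pinner_commute[of Neg "f x"])
  have skew: "pinner Neg (?d X) (Y x) = - pinner Neg (?d Y) (X x)"
    if "X differentiable at x" "Y differentiable at x" "X x \<in> tangent_space L0 Neg (f x)"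
        "Y x \<in> tangent_space L0 Neg (f x)"
      "\<And>y. y \<in> U \<Longrightarrow> pinner Neg (X y) (Y y) = c" for X Y c
    using pinner_frechet_derivative_const[OF that(1,2) U(1,2) that(5), of V]
    unfolding proj[OF that(3)] proj[OF that(4)] by (simp add: pinner_commute[of Neg "X x"])
  have expand: "?d X = pinner Neg (?d X) (e1 x) *\<^sub>R e1 x - pinner Neg (?d X) (e3 x) *\<^sub>R e3 x
     + pinner Neg (?d X) (n x) *\<^sub>R n x - pinner Neg (?d X) (m x) *\<^sub>R m x" for X
  proof -
    interpret timelike_plane L0 Neg idx "f x" "pd 1 f x" "pd 2 f x" "E x"
        by (rule timelike_plane_at[OF x])
    have "L0 * pinner Neg (?d X) (f x) = 0"
      using tangent_proj_tangent[OF in_space[OF x]] by (simp add: nabla_def tangent_space_iff)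
    moreover have "(a / E x) *\<^sub>R u = (exp (- l x) * a) *\<^sub>R (exp (- l x) *\<^sub>R u)" for a and u :: "real^'n"
    proof -
      have "exp (- l x) * a * exp (- l x) = a * (exp (- l x) * exp (- l x))" by (simp only: mult_ac)
      also have "exp (- l x) * exp (- l x) = 1 / E x" by (simp add: mult_exp_exp exp_minus field_simps)
      finally show ?thesis by simp
    qed
    ultimately show ?thesis
      by (subst normal_pair_expansion[OF pair[OF U(2)], of "?d X"])
          (simp only: pinner_scaleR_right, simp)
  qed
  define p q r w t z where pqr: "p = pinner Neg (?d e1) (n x)" "q = pinner Neg (?d e1) (m x)"
    "r = pinner Neg (?d e3) (n x)" "w = pinner Neg (?d e3) (m x)"
    "t = pinner Neg (?d e1) (e3 x)" "z = pinner Neg (?d n) (m x)"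
  have z0: "pinner Neg (?d e1) (e1 x) = 0" "pinner Neg (?d e3) (e3 x) = 0"
    "pinner Neg (?d n) (n x) = 0" "pinner Neg (?d m) (m x) = 0"
    using skew[OF de(1) de(1) tan(1) tan(1) orth(1)] skew[OF de(2) de(2) tan(2) tan(2) orth(2)]
      skew[OF d(1) d(1) tan(3) tan(3) orth(4)] skew[OF d(2) d(2) tan(4) tan(4) orth(5)] by simp_all
  have sk: "pinner Neg (?d e3) (e1 x) = - t" "pinner Neg (?d n) (e1 x) = - p" "pinner Neg (?d m)
      (e1 x) = - q"
    "pinner Neg (?d n) (e3 x) = - r" "pinner Neg (?d m) (e3 x) = - w" "pinner Neg (?d m) (n x) = - z"
    unfolding pqr
    using skew[OF de(1) de(2) tan(1,2) orth(3)] skew[OF de(1) d(1) tan(1,3) orth(7)]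
      skew[OF de(1) d(2) tan(1,4) orth(8)] skew[OF de(2) d(1) tan(2,3) orth(9)]
      skew[OF de(2) d(2) tan(2,4) orth(10)] skew[OF d(1) d(2) tan(3,4) orth(6)] by simp_all
  have dd: "?d e1 = p *\<^sub>R n x - t *\<^sub>R e3 x - q *\<^sub>R m x" "?d e3 = r *\<^sub>R n x - t *\<^sub>R e1 x - w *\<^sub>R m x"
    "?d n = r *\<^sub>R e3 x - p *\<^sub>R e1 x - z *\<^sub>R m x" "?d m = w *\<^sub>R e3 x - q *\<^sub>R e1 x - z *\<^sub>R n x"
    by (subst expand, simp only: z0 sk pqr[symmetric], simp)+
  have "T = nabla_hat L0 Neg f (\<lambda>y. (1 / sqrt 2) *\<^sub>R (bivector (e1 y) (e3 y) + s *\<^sub>R bivector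
      (m y) (n y))) V x"
  proof -
    have "(\<lambda>y. (1 / sqrt 2) *\<^sub>R (bivector (e1 y) (e3 y) + s *\<^sub>R bivector (m y)
        (n y))) differentiable at x"
      by (intro differentiable_add differentiable_bilinear[OF bounded_bilinear_scaleR]
          differentiable_bilinear[OF bounded_bilinear_bivector] differentiable_const de d)
    moreover have "(1 / sqrt 2) *\<^sub>R (bivector (e1 y) (e3 y) + s *\<^sub>R bivector (m y) (n y))
        = twistor_lift L0 Neg idx f s y"
      if "y \<in> U" for y
      using twistor_lift_eq[OF _ pair pos] that U(3) by (metis subsetD)
    ultimately show ?thesis
      unfolding T nabla_hat_def
      by (simp only: frechet_derivative_transform_within_open[OF _ U(1,2), of _
          "twistor_lift L0 Neg idx f s"])
  qed
  also have "\<dots> = (1 / sqrt 2) *\<^sub>R ((bivector (?d e1) (e3 x) + bivector (e1 x) (?d e3))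
      + s *\<^sub>R (bivector (?d m) (n x) + bivector (m x) (?d n)))"
    by (simp only: nabla_hat_combination differentiable_bilinear[OF bounded_bilinear_bivector] de d
        nabla_hat_bivector[where X = e1 and Y = e3 and x = x and f = f and ?L0.0 = L0 and Neg
            = Neg, OF de tan(1,2)]
        nabla_hat_bivector[where X = m and Y = n and x = x and f = f and ?L0.0 = L0 and Neg
            = Neg, OF d(2,1) tan(4,3)])
  finally have T': "T = \<dots>" .
  note o = orth[OF U(2)]
  have ne3: "pinner Neg (n x) (e3 x) = 0" using o(9) by (simp only: pinner_commute)
  have "bivector_inner Neg T T = (r - s * q)\<^sup>2 - (p - s * w)\<^sup>2"
    by (rule moving_frame_norm[OF o(1) o(4) o(2) o(5) o(7) o(3) o(8) ne3 o(6) o(10) dd s T'])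
  moreover have nd: "pinner Neg (?d (\<lambda>y. exp (- l y) *\<^sub>R pd k f y)) v =
      exp (- l x) * (V $ 1 * pinner Neg (second_ff L0 Neg f 1 k x) v + V $ 2
          * pinner Neg (second_ff L0 Neg f 2 k x) v)"
    if "v = n x \<or> v = m x" for v k
  proof -
    interpret timelike_plane L0 Neg idx "f x" "pd 1 f x" "pd 2 f x" "E x"
        by (rule timelike_plane_at[OF x])
    note pr = normal_pair_products[OF pair[OF U(2)]]
    have v: "pinner Neg v (pd 1 f x) = 0" "pinner Neg v (pd 2 f x) = 0" "L0 * pinner Neg v (f x) = 0"
      and vt: "v \<in> tangent_space L0 Neg (f x)"
      using that pr tan by (auto simp: tangent_space_iff)
    have vk: "pinner Neg (pd k f x) v = 0" using v exhaust_2[of k] by (auto simp: pinner_commute)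
    have "pd i (\<lambda>y. exp (- l y) *\<^sub>R pd k f y) x = exp (- l x) *\<^sub>R pd i (pd k f) x + pd i (\<lambda>y. exp
        (- l y)) x *\<^sub>R pd k f x" for i
      by (rule pd_bilinear[OF bounded_bilinear_scaleR dexp dpf[OF x]])
    moreover have "pinner Neg (second_ff L0 Neg f i k x) v = pinner Neg (pd i (pd k f) x) v" for i
      using normal_pinner_nproj[OF x v] by (simp add: second_ff_eq[OF x] pinner_commute[of Neg _ v])
    ultimately show ?thesis
      unfolding proj[OF vt] frechet_derivative_pd[OF differentiable_bilinear[OF
          bounded_bilinear_scaleR dexp dpf[OF x]]]
      by (simp add: pinner_simps vk algebra_simps)
  qed
  have "p = exp (- l x) * (V $ 1 * pinner Neg (\<alpha> x) n0 + V $ 2 * pinner Neg (\<beta> x) n0)"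
    "q = exp (- l x) * (V $ 1 * pinner Neg (\<alpha> x) m0 + V $ 2 * pinner Neg (\<beta> x) m0)"
    "r = exp (- l x) * (V $ 1 * pinner Neg (\<beta> x) n0 + V $ 2 * pinner Neg (\<alpha> x) n0)"
    "w = exp (- l x) * (V $ 1 * pinner Neg (\<beta> x) m0 + V $ 2 * pinner Neg (\<alpha> x) m0)"
    unfolding pqr by (simp_all add: nd nm0 second_ff_11_22[OF x] second_ff_21[OF x])
  ultimately show ?thesis using s by algebra
qed

lemma twistor_lightlike_iff:
  assumes x: "x \<in> D" and nm: "normal_pair_at x n m" "positive_frame L0 idx
      (f x) [pd 1 f x, n, pd 2 f x, m]"
    and s: "s * s = 1"
  shows "(\<forall>V. let T = nabla_hat L0 Neg f (twistor_lift L0 Neg idx f s) V x in bivector_inner Neg T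
      T = 0) \<longleftrightarrow>
    (pinner Neg (\<beta> x) n - s * pinner Neg (\<alpha> x) m)\<^sup>2 = (pinner Neg (\<alpha> x) n - s * pinner Neg (\<beta> x) m)\<^sup>2"
proof -
  have "(\<forall>V. let T = nabla_hat L0 Neg f (twistor_lift L0 Neg idx f s) V x in bivector_inner Neg T
      T = 0) \<longleftrightarrow>
    (\<forall>V::real^2. ((V $ 1)\<^sup>2 - (V $ 2)\<^sup>2) *
    ((pinner Neg (\<beta> x) n - s * pinner Neg (\<alpha> x) m)\<^sup>2 - (pinner Neg (\<alpha> x) n - s
        * pinner Neg (\<beta> x) m)\<^sup>2) = 0)"
    unfolding Let_def twistor_derivative_norm[OF x nm s refl] by simp
  also have "\<dots> \<longleftrightarrow> (pinner Neg (\<beta> x) n - s * pinner Neg (\<alpha> x) m)\<^sup>2 = (pinner Neg (\<alpha> x) n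
      - s * pinner Neg (\<beta> x) m)\<^sup>2"
    by (auto dest: spec[of _ "axis 1 1 :: real^2"] simp: axis_def)
  finally show ?thesis .
qed

text \<open>The sum and the difference of the conditions for the two signs are balance and parallelism.\<close>

lemma twistor_both_iff:
  assumes x: "x \<in> D"
  shows "(\<forall>s\<in>{1, - 1}. \<forall>V. let T = nabla_hat L0 Neg f (twistor_lift L0 Neg idx f s) V x in
      bivector_inner Neg T T = 0)
    \<longleftrightarrow> balanced_at x \<and> parallel_at x"
proof -
  obtain n m where nm: "normal_pair_at x n m" "positive_frame L0 idx (f x) [pd 1 f x, n, pd 2 f x, m]"
    using ex_normal_pair_at[OF x] by blast
  let ?an = "pinner Neg (\<alpha> x) n" and ?am = "pinner Neg (\<alpha> x) m"
    and ?bn = "pinner Neg (\<beta> x) n" and ?bm = "pinner Neg (\<beta> x) m"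
  have bal: "balanced_at x \<longleftrightarrow> ?an * ?an - ?am * ?am = ?bn * ?bn - ?bm * ?bm"
    unfolding balanced_at_def
    using normal_products[OF x nm(1) second_ff_normal[OF x], of 1 1 "\<alpha> x"]
      normal_products[OF x nm(1) second_ff_normal[OF x], of 1 2 "\<beta> x"] by simp
  have "(\<forall>s\<in>{1, - 1}. \<forall>V. let T = nabla_hat L0 Neg f (twistor_lift L0 Neg idx f s) V x in
      bivector_inner Neg T T = 0)
    \<longleftrightarrow> (?bn - ?am)\<^sup>2 = (?an - ?bm)\<^sup>2 \<and> (?bn + ?am)\<^sup>2 = (?an + ?bm)\<^sup>2"
    using twistor_lightlike_iff[OF x nm, of 1] twistor_lightlike_iff[OF x nm, of "- 1"] by simp
  also have "\<dots> \<longleftrightarrow> balanced_at x \<and> parallel_at x"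
    unfolding bal parallel_at_frame[OF x nm(1)] power2_eq_square by (auto simp: algebra_simps)
  finally show ?thesis .
qed

end

section \<open>The equivalences\<close>

lemma chart_patch:
  assumes "neutral_ambient L0 Neg" "bij_betw idx UNIV {..<CARD('n)}"
    and "lorentz_surface A" "timelike_conformal_immersion L0 Neg A F" "zero_mean_curvature L0 Neg A F"
    and c: "c \<in> A"
  obtains l where "timelike_patch L0 (Neg :: 'n::finite set) idx (chart_dom c) (local_rep F c) l"
proof -
  obtain l where l: "smooth_on (chart_dom c) l"
    "\<And>x. x \<in> chart_dom c \<Longrightarrow> pinner Neg (pd 1 (local_rep F c) x) (pd 1 (local_rep F c) x) = exp (2 * l x)"
    "\<And>x. x \<in> chart_dom c \<Longrightarrow> pinner Neg (pd 1 (local_rep F c) x) (pd 2 (local_rep F c) x) = 0"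
    "\<And>x. x \<in> chart_dom c \<Longrightarrow> pinner Neg (pd 2 (local_rep F c) x) (pd 2 (local_rep F c) x) = - exp
        (2 * l x)"
    using assms(4) c unfolding timelike_conformal_immersion_def Let_def by metis
  have "timelike_patch L0 Neg idx (chart_dom c) (local_rep F c) l"
  proof
    show "local_rep F c x \<in> space_form L0 Neg" for x
      using assms(4) by (auto simp: timelike_conformal_immersion_def local_rep_def)
    show "smooth_on (chart_dom c) (local_rep F c)"
      using assms(4) c by (auto simp: timelike_conformal_immersion_def Let_def)
    show "open (chart_dom c)" using assms(3) c by (simp add: lorentz_surface_def)
    show "mean_curvature L0 Neg (local_rep F c) x = 0" if "x \<in> chart_dom c" for x
      using assms(5) c that by (simp add: zero_mean_curvature_def)
  qed (use assms(1,2) l in auto)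
  then show thesis by (rule that)
qed

context timelike_patch
begin

lemma curvature_iff_twistor:
  "(\<forall>x\<in>D. gauss_curvature (induced_metric Neg f) x = L0) \<longleftrightarrow>
   (\<forall>x\<in>D. \<forall>s\<in>{1, - 1}. \<forall>V. let T = nabla_hat L0 Neg f (twistor_lift L0 Neg idx f s) V x in
       bivector_inner Neg T T = 0)"
  using constant_curvature_parallel curvature_balanced twistor_both_iff by blast

lemma curvature_iff_flat_normal:
  "(\<forall>x\<in>D. gauss_curvature (induced_metric Neg f) x = L0) \<longleftrightarrow>
   (\<forall>\<xi>. normal_section L0 Neg D f \<xi> \<longrightarrow> (\<forall>x\<in>D. \<forall>i j. normal_curvature L0 Neg f i j \<xi> x = 0)) \<and>
   (\<forall>x\<in>D. let q = quartic_coeff L0 Neg f x in q = 0 \<or> para_null q)"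
proof -
  have "balanced_at x \<longleftrightarrow> (let q = quartic_coeff L0 Neg f x in q = 0 \<or> para_null q)"
    if x: "x \<in> D" and par: "parallel_at x" for x
  proof -
    let ?a = "pinner Neg (\<alpha> x) (\<alpha> x)" and ?b = "pinner Neg (\<beta> x) (\<beta> x)" and ?c = "pinner Neg (\<alpha> x)
        (\<beta> x)"
    have "(?a + ?b)\<^sup>2 - 4 * ?c\<^sup>2 = (?a - ?b)\<^sup>2"
      using par unfolding parallel_at_def by algebra
    then show ?thesis
      unfolding Let_def quartic_null[OF x] balanced_at_def
      by (metis eq_iff_diff_eq_0 zero_eq_power2)
  qed
  then show ?thesis
    unfolding flat_normal_iff using constant_curvature_parallel curvature_balanced by blast
qed

end

theorem theorem4p2:
  fixes L0 :: real
    and Neg :: "'n::finite set"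
    and idx :: "'n \<Rightarrow> nat"
    and A :: "'m::{t2_space,second_countable_topology} chart set"
    and F :: "'m \<Rightarrow> real^'n"
  assumes "neutral_ambient L0 Neg"
    and "bij_betw idx UNIV {..<CARD('n)}"
    and "lorentz_surface A"
    and "timelike_conformal_immersion L0 Neg A F"
    and "zero_mean_curvature L0 Neg A F"
  shows "(induced_curvature_constant L0 Neg A F \<longleftrightarrow>
            twistor_derivative_lightlike L0 Neg idx A F 1 \<and>
            twistor_derivative_lightlike L0 Neg idx A F (-1))
       \<and> (induced_curvature_constant L0 Neg A F \<longleftrightarrow>
            flat_normal_connection L0 Neg A F \<and> quartic_zero_or_null L0 Neg A F)"
proof -
  let ?K = "\<lambda>c. \<forall>x\<in>chart_dom c. gauss_curvature (induced_metric Neg (local_rep F c)) x = L0"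
  let ?T = "\<lambda>c s. \<forall>x\<in>chart_dom c. \<forall>V. let f = local_rep F c;
        T = nabla_hat L0 Neg f (twistor_lift L0 Neg idx f s) V x in bivector_inner Neg T T = 0"
  let ?R = "\<lambda>c. \<forall>\<xi>. normal_section L0 Neg (chart_dom c) (local_rep F c) \<xi> \<longrightarrow>
        (\<forall>x\<in>chart_dom c. \<forall>i j. normal_curvature L0 Neg (local_rep F c) i j \<xi> x = 0)"
  let ?Q = "\<lambda>c. \<forall>x\<in>chart_dom c. let q = quartic_coeff L0 Neg (local_rep F c) x in q = 0 \<or> para_null q"
  have "(?K c \<longleftrightarrow> ?T c 1 \<and> ?T c (- 1)) \<and> (?K c \<longleftrightarrow> ?R c \<and> ?Q c)" if c: "c \<in> A" for c
  proof -
    obtain l where "timelike_patch L0 Neg idx (chart_dom c) (local_rep F c) l"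
      using chart_patch[OF assms c] by blast
    then interpret timelike_patch L0 Neg idx "chart_dom c" "local_rep F c" l .
    show ?thesis
      using curvature_iff_twistor curvature_iff_flat_normal by (simp add: Let_def) blast
  qed
  then show ?thesis
    unfolding induced_curvature_constant_def twistor_derivative_lightlike_def
      flat_normal_connection_def quartic_zero_or_null_def by blast
qed

end
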